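(* Let $F$ be a field of characteristic $0$. Then $Id(\mathcal{A},* ) = I$, where $\mathcal{A}$ is the algebra of $4\times 4$ block matrices $\begin{pmatrix} A & C\\ 0 & B\end{pmatrix}$ with $A,B,C\in UT_2(F)$, equipped with the reflection involution $*$, and $I$ is the $T( * )$-ideal of $F\langle Y\cup Z\rangle$ generated by the following polynomials: (1) $v_1v_2v_3$, for all commutators $v_1,v_2,v_3$ of $F\langle Y\cup Z\rangle$; (2) $v_1uv_2 - v_2^*u^*v_1^*$ and $v_1v_2u-u^*v_2^*v_1^*$, for all commutators $v_1,v_2$ of $F\langle Y\cup Z\rangle$ and all $u\in Y\cup Z$; (3) $[y_1,y_2][y_3,y_4]+[y_2,y_3][y_1,y_4]+[y_3,y_1][y_2,y_4]$ and $[y_1,y_2,y_4][y_3,y_5]+[y_2,y_3,y_4][y_1,y_5]+[y_3,y_1,y_4][y_2,y_5]$.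
   Context: $UT_k(F)$ is the algebra of $k\times k$ upper triangular matrices over $F$. The reflection involution on $UT_k(F)$ is $A^*=JA^tJ$, where $A^t$ is the transpose and $J$ is the permutation matrix with $1$'s on the antidiagonal; it restricts to an involution on the subalgebra $\mathcal{A}\subseteq UT_4(F)$. Put $\mathcal{A}^+=\{a\in\mathcal{A}: a^*=a\}$ and $\mathcal{A}^-=\{a\in\mathcal{A}: a^*=-a\}$. $Y=\{y_1,y_2,\ldots\}$ and $Z=\{z_1,z_2,\ldots\}$ are disjoint infinite sets of variables, and $F\langle Y\cup Z\rangle$ is the free unitary associative algebra on $Y\cup Z$, with the involution $*$ determined by $y_i^*=y_i$, $z_i^*=-z_i$. A polynomial $f(y_1,\ldots,y_n,z_1,\ldots,z_m)\in F\langle Y\cup Z\rangle$ is a $*$-polynomial identity for $\mathcal{A}$ if $f(a_1,\ldots,a_n,b_1,\ldots,b_m)=0$ for all $a_i\in\mathcal{A}^+$, $b_j\in\mathcal{A}^-$; $Id(\mathcal{A},* )$ is the set of all of these. A $T( * )$-ideal is a two-sided ideal of $F\langle Y\cup Z\rangle$ that is closed under $*$ and under all algebra endomorphisms $\varphi$ of $F\langle Y\cup Z\rangle$ with $\varphi(f^* )=\varphi(f)^*$ for all $f$ (equivalently, closed under replacing each $y_i$ by a symmetric element and each $z_i$ by a skew-symmetric element of $F\langle Y\cup Z\rangle$). The $T( * )$-ideal generated by a set is the smallest $T( * )$-ideal containing it. Commutators are left-normed: $[a_1,a_2]=a_1a_2-a_2a_1$ and $[a_1,\ldots,a_n]=[[a_1,\ldots,a_{n-1}],a_n]$;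 a commutator of $F\langle Y\cup Z\rangle$ is an element $[a_1,\ldots,a_n]$ with $n\ge 2$ and $a_i\in F\langle Y\cup Z\rangle$. *)

theory Defs
  imports "Jordan_Normal_Form.Matrix" "HOL-Library.Poly_Mapping"
begin

section \<open>The free algebra with involution\<close>

datatype var = Y nat | Z nat

text \<open>The free monoid, written additively so that finitely supported functions on it form the
  monoid algebra of \<open>HOL-Library.Poly_Mapping\<close>.\<close>

datatype 'a free_mon = Word (letters: "'a list")

instantiation free_mon :: (type) monoid_add
begin

definition zero_free_mon :: "'a free_mon" where
  "0 = Word []"

definition plus_free_mon :: "'a free_mon \<Rightarrow> 'a free_mon \<Rightarrow> 'a free_mon" where
  "u + v = Word (letters u @ letters v)"

instance
  by standard (simp_all add: zero_free_mon_def plus_free_mon_def)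

end

type_synonym 'a free_alg = "var free_mon \<Rightarrow>\<^sub>0 'a"

definition gen :: "var \<Rightarrow> 'a::field free_alg" where
  "gen x = Poly_Mapping.single (Word [x]) 1"

definition smult_free :: "'a::field \<Rightarrow> 'a free_alg \<Rightarrow> 'a free_alg" where
  "smult_free c f = Poly_Mapping.map ((*) c) f"

fun var_sign :: "var \<Rightarrow> 'a::field" where
  "var_sign (Y i) = 1"
| "var_sign (Z i) = - 1"

text \<open>The involution sends a word \<open>x\<^sub>1 \<dots> x\<^sub>n\<close> to \<open>x\<^sub>n\<^sup>* \<dots> x\<^sub>1\<^sup>*\<close>, with one sign for each letter
  \<open>Z i\<close>, and is extended linearly. The lemmas below show that it is the
  antiautomorphism fixing every \<open>Y i\<close> and negating every \<open>Z i\<close>.\<close>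

definition star_word :: "var free_mon \<Rightarrow> 'a::field free_alg" where
  "star_word w = Poly_Mapping.single (Word (rev (letters w))) (prod_list (map var_sign (letters w)))"

definition star :: "'a::field free_alg \<Rightarrow> 'a free_alg" where
  "star f = (\<Sum>w\<in>Poly_Mapping.keys f. smult_free (Poly_Mapping.lookup f w) (star_word w))"

lemma lookup_smult_free [simp]:
  "Poly_Mapping.lookup (smult_free c f) w = c * Poly_Mapping.lookup f w"
  unfolding smult_free_def by transfer (simp add: when_def)

lemma star_superset:
  assumes "finite S" and "Poly_Mapping.keys f \<subseteq> S"
  shows "star f = (\<Sum>w\<in>S. smult_free (Poly_Mapping.lookup f w) (star_word w))"
  unfolding star_def
  by (rule sum.mono_neutral_left)
     (use assms in \<open>auto simp: in_keys_iff intro!: poly_mapping_eqI\<close>)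

lemma star_add: "star (f + g) = star f + star g"
proof -
  let ?S = "Poly_Mapping.keys f \<union> Poly_Mapping.keys g"
  have "star (f + g) = (\<Sum>w\<in>?S. smult_free (Poly_Mapping.lookup (f + g) w) (star_word w))"
    by (rule star_superset) (auto simp: in_keys_iff lookup_add)
  also have "\<dots> = (\<Sum>w\<in>?S. smult_free (Poly_Mapping.lookup f w) (star_word w)
      + smult_free (Poly_Mapping.lookup g w) (star_word w))"
    by (rule sum.cong) (auto intro!: poly_mapping_eqI simp: lookup_add algebra_simps)
  also have "\<dots> = star f + star g"
    by (simp add: sum.distrib star_superset[of ?S f] star_superset[of ?S g])
  finally show ?thesis .
qed

lemma star_zero [simp]: "star 0 = 0"
  by (simp add: star_def)

lemma star_sum: "star (sum f S) = (\<Sum>x\<in>S. star (f x))"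
  by (induction S rule: infinite_finite_induct) (simp_all add: star_add)

lemma star_single: "star (Poly_Mapping.single w c) =
    Poly_Mapping.single (Word (rev (letters w))) (c * prod_list (map var_sign (letters w)))"
  by (subst star_superset[of "{w}"])
     (auto simp: star_word_def lookup_single when_def intro!: poly_mapping_eqI)

lemma star_Y [simp]: "star (gen (Y i)) = gen (Y i)"
  and star_Z [simp]: "star (gen (Z i)) = - gen (Z i)"
  by (simp_all add: gen_def star_single single_uminus)

lemma star_smult: "star (smult_free c f) = smult_free c (star f)"
proof -
  have "star (smult_free c f) = (\<Sum>w\<in>Poly_Mapping.keys f.
      smult_free (Poly_Mapping.lookup (smult_free c f) w) (star_word w))"
    by (rule star_superset) (auto simp: in_keys_iff)
  then show ?thesis
    by (auto intro!: poly_mapping_eqI simp: star_def lookup_sum sum_distrib_left mult.assoc)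
qed

lemma free_alg_expand:
  "f = (\<Sum>w\<in>Poly_Mapping.keys f. Poly_Mapping.single w (Poly_Mapping.lookup f w))"
  by (rule poly_mapping_eqI) (auto simp: lookup_sum lookup_single when_def in_keys_iff)

lemma star_mult: "star (f * g) = star g * star f"
proof -
  let ?s = "\<lambda>f w. Poly_Mapping.single w (Poly_Mapping.lookup f w)"
  have "star (f * g) =
      star (\<Sum>u\<in>Poly_Mapping.keys f. \<Sum>v\<in>Poly_Mapping.keys g. ?s f u * ?s g v)"
    by (subst free_alg_expand[of f], subst free_alg_expand[of g])
       (simp add: sum_product)
  also have "\<dots> = (\<Sum>u\<in>Poly_Mapping.keys f. \<Sum>v\<in>Poly_Mapping.keys g.
      star (?s g v) * star (?s f u))"
    by (simp add: star_sum mult_single star_single plus_free_mon_def mult_ac)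
  also have "\<dots> = star (\<Sum>v\<in>Poly_Mapping.keys g. ?s g v)
      * star (\<Sum>u\<in>Poly_Mapping.keys f. ?s f u)"
    unfolding star_sum sum_product by (rule sum.swap)
  finally show ?thesis
    by (simp flip: free_alg_expand)
qed

lemma star_star [simp]: "star (star f) = f"
proof -
  have sq: "prod_list (map var_sign xs) * prod_list (map var_sign xs) = (1 :: 'a)" for xs
  proof (induction xs)
    case (Cons x xs)
    then show ?case by (cases x) simp_all
  qed simp
  have "star (star (Poly_Mapping.single w c)) = Poly_Mapping.single w c" for w and c :: 'a
    by (simp add: star_single rev_map[symmetric] prod_list.rev mult.assoc sq)
  then show ?thesis
    by (subst (1 2) free_alg_expand[of f]) (simp add: star_sum)
qed


section \<open>Ideals invariant under endomorphisms commuting with the involution\<close>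

definition star_endo :: "('a::field free_alg \<Rightarrow> 'a free_alg) \<Rightarrow> bool" where
  "star_endo \<phi> \<longleftrightarrow>
     \<phi> 1 = 1 \<and>
     (\<forall>f g. \<phi> (f + g) = \<phi> f + \<phi> g) \<and>
     (\<forall>f g. \<phi> (f * g) = \<phi> f * \<phi> g) \<and>
     (\<forall>c f. \<phi> (smult_free c f) = smult_free c (\<phi> f)) \<and>
     (\<forall>f. \<phi> (star f) = star (\<phi> f))"

definition two_sided_ideal :: "'a::field free_alg set \<Rightarrow> bool" where
  "two_sided_ideal I \<longleftrightarrow>
     0 \<in> I \<and>
     (\<forall>f\<in>I. \<forall>g\<in>I. f + g \<in> I) \<and>
     (\<forall>f\<in>I. \<forall>g. g * f \<in> I \<and> f * g \<in> I)"

definition T_star_ideal :: "'a::field free_alg set \<Rightarrow> bool" where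
  "T_star_ideal I \<longleftrightarrow>
     two_sided_ideal I \<and>
     (\<forall>f\<in>I. star f \<in> I) \<and>
     (\<forall>\<phi>. star_endo \<phi> \<longrightarrow> (\<forall>f\<in>I. \<phi> f \<in> I))"


section \<open>The matrix algebra and its identities\<close>

definition UT :: "nat \<Rightarrow> 'a::field mat set" where
  "UT k = {A \<in> carrier_mat k k. upper_triangular A}"

definition antidiag_mat :: "nat \<Rightarrow> 'a::field mat" where
  "antidiag_mat k = mat k k (\<lambda>(i, j). if i + j + 1 = k then 1 else 0)"

definition reflection :: "nat \<Rightarrow> 'a::field mat \<Rightarrow> 'a mat" where
  "reflection k A = antidiag_mat k * transpose_mat A * antidiag_mat k"

definition block_alg :: "'a::field mat set" where
  "block_alg = {four_block_mat A C (0\<^sub>m 2 2) B | A B C. A \<in> UT 2 \<and> B \<in> UT 2 \<and> C \<in> UT 2}"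

definition sym_part :: "'a::field mat set" where
  "sym_part = {a \<in> block_alg. reflection 4 a = a}"

definition skew_part :: "'a::field mat set" where
  "skew_part = {a \<in> block_alg. reflection 4 a = - a}"

definition eval_word :: "(var \<Rightarrow> 'a::field mat) \<Rightarrow> var free_mon \<Rightarrow> 'a mat" where
  "eval_word \<sigma> w = foldr (\<lambda>x M. \<sigma> x * M) (letters w) (1\<^sub>m 4)"

definition eval_free :: "(var \<Rightarrow> 'a::field mat) \<Rightarrow> 'a free_alg \<Rightarrow> 'a mat" where
  "eval_free \<sigma> f =
     finsum (ring_mat TYPE('a) 4 ()) (\<lambda>w. Poly_Mapping.lookup f w \<cdot>\<^sub>m eval_word \<sigma> w)
       (Poly_Mapping.keys f)"

definition star_identities :: "'a::field free_alg set" where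
  "star_identities =
     {f. \<forall>\<sigma>. (\<forall>i. \<sigma> (Y i) \<in> sym_part) \<and> (\<forall>j. \<sigma> (Z j) \<in> skew_part)
            \<longrightarrow> eval_free \<sigma> f = 0\<^sub>m 4 4}"


section \<open>The generating polynomials\<close>

definition bracket :: "'a::field free_alg \<Rightarrow> 'a free_alg \<Rightarrow> 'a free_alg" where
  "bracket f g = f * g - g * f"

fun left_normed :: "'a::field free_alg list \<Rightarrow> 'a free_alg" where
  "left_normed (a # as) = foldl bracket a as"
| "left_normed [] = 0"

definition commutators :: "'a::field free_alg set" where
  "commutators = {left_normed as | as. length as \<ge> 2}"

definition gens1 :: "'a::field free_alg set" where
  "gens1 = {v1 * v2 * v3 | v1 v2 v3.
     v1 \<in> commutators \<and> v2 \<in> commutators \<and> v3 \<in> commutators}"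

definition gens2 :: "'a::field free_alg set" where
  "gens2 =
     {v1 * gen x * v2 - star v2 * star (gen x) * star v1 | v1 v2 x.
        v1 \<in> commutators \<and> v2 \<in> commutators} \<union>
     {v1 * v2 * gen x - star (gen x) * star v2 * star v1 | v1 v2 x.
        v1 \<in> commutators \<and> v2 \<in> commutators}"

definition gens3 :: "'a::field free_alg set" where
  "gens3 = (let y = (\<lambda>i. gen (Y i)) in
     {left_normed [y 1, y 2] * left_normed [y 3, y 4]
        + left_normed [y 2, y 3] * left_normed [y 1, y 4]
        + left_normed [y 3, y 1] * left_normed [y 2, y 4],
      left_normed [y 1, y 2, y 4] * left_normed [y 3, y 5]
        + left_normed [y 2, y 3, y 4] * left_normed [y 1, y 5]
        + left_normed [y 3, y 1, y 4] * left_normed [y 2, y 5]})"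

end

theory Submission
  imports Defs
begin

text \<open>An identity is detected on the generic element of the algebra, whose entries are polynomials.
  Its diagonal entry shows that it lies in the commutator ideal \<open>C\<close>, and its entry (1,2) that it lies in
  \<open>C\<^sup>2\<close>. Modulo the generated ideal, \<open>C\<^sup>2\<close> is spanned by elements \<open>u v w\<^sup>*\<close>, with \<open>u\<close> a word in the
  symmetric variables and \<open>v\<close>, \<open>w\<close> iterated commutators of variables, and \<open>u v w\<^sup>* = u w v\<^sup>*\<close>. Writing \<open>t\<close> and
  \<open>s\<close> for the differences of the diagonal entries (1,1), (2,2) and (1,1), (3,3), and \<open>c\<close>, \<open>d\<close> for the entries
  (1,2), (1,3), the entry (1,4) of \<open>v w\<^sup>*\<close> for \<open>v = [x\<^sub>i, x\<^sub>j]\<close>, \<open>w = [x\<^sub>k, x\<^sub>l]\<close> is the symmetrization of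
  \<open>(t\<^sub>i c\<^sub>j - t\<^sub>j c\<^sub>i) (s\<^sub>k d\<^sub>l - s\<^sub>l d\<^sub>k)\<close>. A commutator is thus a Koszul boundary, and Euler's homotopy for
  the Koszul complex recovers \<open>v w\<^sup>*\<close> from its entry (1,4), using only the Jacobi identity. The one exception
  occurs when all variables are symmetric: then \<open>s = t\<close>, and the Pluecker relation (3) is needed as well.
  Ideal membership is tested by linear functionals, so that congruences become equations in the field.\<close>

section \<open>Linear algebra in the free algebra\<close>

text \<open>No basis of the relatively free algebra is constructed. A functional \<phi> vanishing on
  the ideal is shown to factor through an entry of the generic element: values on monomials are
  prescribed whose linear extension, applied to that entry, is a nonzero multiple of \<phi> on a
  spanning set. An identity has zero entries, so \<phi> cannot separate it from the ideal. This
  requires independent parameters. The entry (1,1), called \<open>a\<close>, satisfies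
  \<open>2 a = t + s\<close> for a skew variable, while \<open>s = t\<close> for a symmetric one, so
  each variable has just two free diagonal parameters. This is why skew letters are cleared from
  \<open>u\<close> before the entry (1,4) is read. For a symmetric letter the monomial does not tell
  whether it came from \<open>v\<close> or from \<open>w\<close>; one factor is therefore contracted
  along skew letters, whose origin is known. If there are none, both contractions draw from a common
  pool, and only there the Pluecker relation has to intervene. Characteristic 0 makes the degrees
  and the factor 2 of the symmetrization invertible.\<close>

interpretation fa: vector_space "smult_free :: 'a::field \<Rightarrow> 'a free_alg \<Rightarrow> 'a free_alg"
  by standard (auto intro!: poly_mapping_eqI simp: lookup_add algebra_simps)

definition functional :: "('a::field free_alg \<Rightarrow> 'a) \<Rightarrow> bool" where
  "functional \<phi> \<longleftrightarrow>
     (\<forall>f g. \<phi> (f + g) = \<phi> f + \<phi> g) \<and> (\<forall>c f. \<phi> (smult_free c f) = c * \<phi> f)"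

lemma functional_separates:
  fixes f :: "'a::field free_alg"
  assumes "fa.subspace J" and "f \<notin> J"
  obtains \<phi> where "functional \<phi>" and "\<And>g. g \<in> J \<Longrightarrow> \<phi> g = 0" and "\<phi> f = 1"
proof -
  interpret pair: vector_space_pair
    "smult_free :: 'a \<Rightarrow> 'a free_alg \<Rightarrow> 'a free_alg" "(*) :: 'a \<Rightarrow> 'a \<Rightarrow> 'a"
    by standard (simp_all add: algebra_simps)
  obtain B where B: "B \<subseteq> J" "fa.independent B" "J \<subseteq> fa.span B"
    by (rule fa.basis_exists)
  have "fa.span B \<subseteq> J"
    using B(1) assms(1) by (rule fa.span_minimal)
  with assms(2) have f: "f \<notin> fa.span B"
    by blast
  with B(2) have "fa.independent (insert f B)"
    by (simp add: fa.independent_insert)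
  then obtain \<phi> where \<phi>: "Vector_Spaces.linear smult_free (*) \<phi>" "\<forall>g\<in>insert f B. \<phi> g = (if g = f then 1 else 0)"
    using pair.linear_independent_extend[of "insert f B" "\<lambda>g. if g = f then 1 else 0"] by blast
  have "\<phi> g = 0" if "g \<in> fa.span B" for g
  proof (rule pair.linear_eq_0_on_span[OF \<phi>(1) _ that])
    show "\<phi> b = 0" if "b \<in> B" for b
      using \<phi>(2) that f by (auto dest: fa.span_base)
  qed
  moreover have "functional \<phi>"
    using pair.linear_add[OF \<phi>(1)] pair.linear_scale[OF \<phi>(1)] by (simp add: functional_def)
  ultimately show thesis
    using that[of \<phi>] \<phi>(2) B(3) by auto
qed

lemma smult_free_conv_single: "smult_free c f = Poly_Mapping.single 0 c * f"
  by (simp add: smult_free_def mult_map_scale_conv_mult)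

lemma smult_free_mult_left: "smult_free c f * g = smult_free c (f * g)"
  and smult_free_mult_right: "f * smult_free c g = smult_free c (f * g)"
  for f g :: "'a::field free_alg"
proof -
  show "smult_free c f * g = smult_free c (f * g)"
    by (simp add: smult_free_conv_single mult.assoc)
  let ?f = "\<Sum>w\<in>Poly_Mapping.keys f. Poly_Mapping.single w (Poly_Mapping.lookup f w)"
  have "?f * Poly_Mapping.single 0 c = Poly_Mapping.single 0 c * ?f"
    by (simp add: sum_distrib_left sum_distrib_right mult_single mult.commute)
  then have "f * Poly_Mapping.single 0 c = Poly_Mapping.single 0 c * f"
    by (simp flip: free_alg_expand)
  then show "f * smult_free c g = smult_free c (f * g)"
    by (simp add: smult_free_conv_single flip: mult.assoc)
qed

lemma smult_free_minus_one: "smult_free (- 1) f = - f"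
  by (rule poly_mapping_eqI) simp

lemma letters_zero [simp]: "letters 0 = []"
  by (simp add: zero_free_mon_def)

lemma functional_add: "functional \<phi> \<Longrightarrow> \<phi> (f + g) = \<phi> f + \<phi> g"
  and functional_scale: "functional \<phi> \<Longrightarrow> \<phi> (smult_free c f) = c * \<phi> f"
  by (simp_all add: functional_def)

lemma functional_zero: "functional \<phi> \<Longrightarrow> \<phi> 0 = 0"
  using functional_scale[of \<phi> 0 0] by simp

lemma functional_uminus: "functional \<phi> \<Longrightarrow> \<phi> (- f) = - \<phi> f"
  using functional_scale[of \<phi> "- 1" f] by (simp add: smult_free_minus_one)

lemma functional_diff: "functional \<phi> \<Longrightarrow> \<phi> (f - g) = \<phi> f - \<phi> g"
  using functional_add[of \<phi> f "- g"] by (simp add: functional_uminus)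

lemma star_one [simp]: "star 1 = (1 :: 'a::field free_alg)"
  using star_single[of 0 1] by (simp flip: zero_free_mon_def)

lemma star_uminus: "star (- f) = - star f"
  using star_smult[of "- 1" f] by (simp add: smult_free_minus_one)

lemma star_diff: "star (f - g) = star f - star g"
  using star_add[of f "- g"] by (simp add: star_uminus)

definition word :: "var list \<Rightarrow> 'a::field free_alg" where
  "word xs = prod_list (map gen xs)"

lemma word_Nil [simp]: "word [] = 1"
  and word_Cons: "word (x # xs) = gen x * word xs"
  and word_append: "word (xs @ ys) = word xs * word ys"
  by (simp_all add: word_def)

lemma word_conv_single: "word xs = Poly_Mapping.single (Word xs) 1"
proof (induction xs)
  case Nil
  show ?case
    by (simp flip: zero_free_mon_def)
next
  case (Cons x xs)
  then show ?case
    by (simp add: word_Cons gen_def mult_single plus_free_mon_def)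
qed

lemma span_words: "fa.span (range word) = (UNIV :: 'a::field free_alg set)"
proof -
  have "f \<in> fa.span (range word)" for f :: "'a free_alg"
  proof -
    have "f = (\<Sum>w\<in>Poly_Mapping.keys f. smult_free (Poly_Mapping.lookup f w) (word (letters w)))"
      by (subst free_alg_expand, intro sum.cong refl poly_mapping_eqI)
         (simp add: word_conv_single lookup_single when_def)
    also have "\<dots> \<in> fa.span (range word)"
      by (intro fa.span_sum fa.span_scale fa.span_base) simp
    finally show ?thesis .
  qed
  then show ?thesis
    by blast
qed

lemma free_alg_induct [case_names add scale one gen]:
  assumes "\<And>f g. P f \<Longrightarrow> P g \<Longrightarrow> P (f + g)" and "\<And>c f. P f \<Longrightarrow> P (smult_free c f)"
    and "P 1" and "\<And>x f. P f \<Longrightarrow> P (gen x * f)"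
  shows "P (f :: 'a::field free_alg)"
proof -
  have word: "P (word xs)" for xs
    using assms(3,4) by (induction xs) (auto simp: word_Cons)
  have zero: "P 0"
    using assms(2)[OF assms(3), of 0] by simp
  have "f \<in> fa.span (range word)"
    by (simp add: span_words)
  then show ?thesis
    by (induction rule: fa.span_induct_alt) (auto intro: assms(1,2) word zero)
qed

section \<open>Evaluation homomorphisms\<close>

text \<open>A central unital homomorphism from the field makes the target an algebra. One
  development of evaluation then serves the free algebra itself (substitutions), the block algebra
  over the field (identities) and the block algebra over polynomials (the generic element).\<close>

locale scalars =
  fixes \<kappa> :: "'a::field \<Rightarrow> 'b::ring_1"
  assumes zero: "\<kappa> 0 = 0" and one: "\<kappa> 1 = 1" and add: "\<kappa> (c + d) = \<kappa> c + \<kappa> d"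
    and mult: "\<kappa> (c * d) = \<kappa> c * \<kappa> d" and central: "\<kappa> c * x = x * \<kappa> c"
begin

definition feval :: "(var \<Rightarrow> 'b) \<Rightarrow> 'a free_alg \<Rightarrow> 'b" where
  "feval \<theta> f = (\<Sum>w\<in>Poly_Mapping.keys f. \<kappa> (Poly_Mapping.lookup f w) * prod_list (map \<theta> (letters w)))"

lemma feval_superset:
  assumes "finite S" and "Poly_Mapping.keys f \<subseteq> S"
  shows "feval \<theta> f = (\<Sum>w\<in>S. \<kappa> (Poly_Mapping.lookup f w) * prod_list (map \<theta> (letters w)))"
  unfolding feval_def by (rule sum.mono_neutral_left) (use assms in \<open>auto simp: in_keys_iff zero\<close>)

lemma feval_add: "feval \<theta> (f + g) = feval \<theta> f + feval \<theta> g"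
proof -
  let ?S = "Poly_Mapping.keys f \<union> Poly_Mapping.keys g"
  have "feval \<theta> h = (\<Sum>w\<in>?S. \<kappa> (Poly_Mapping.lookup h w) * prod_list (map \<theta> (letters w)))"
    if "h \<in> {f, g, f + g}" for h
    by (rule feval_superset) (use that in \<open>auto simp: in_keys_iff lookup_add\<close>)
  then show ?thesis
    by (simp add: lookup_add add distrib_right sum.distrib)
qed

lemma feval_zero [simp]: "feval \<theta> 0 = 0"
  by (simp add: feval_def)

lemma feval_uminus: "feval \<theta> (- f) = - feval \<theta> f"
  using feval_add[of \<theta> f "- f"] by (simp add: eq_neg_iff_add_eq_0 add.commute)

lemma feval_diff: "feval \<theta> (f - g) = feval \<theta> f - feval \<theta> g"
  using feval_add[of \<theta> f "- g"] by (simp add: feval_uminus)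

lemma feval_sum: "feval \<theta> (sum f S) = (\<Sum>x\<in>S. feval \<theta> (f x))"
  by (induction S rule: infinite_finite_induct) (simp_all add: feval_add)

lemma feval_single: "feval \<theta> (Poly_Mapping.single w c) = \<kappa> c * prod_list (map \<theta> (letters w))"
  by (subst feval_superset[of "{w}"]) auto

lemma feval_one [simp]: "feval \<theta> 1 = 1"
  using feval_single[of \<theta> 0 1] by (simp add: one)

lemma feval_gen [simp]: "feval \<theta> (gen x) = \<theta> x"
  by (simp add: gen_def feval_single one)

lemma feval_mult: "feval \<theta> (f * g) = feval \<theta> f * feval \<theta> g"
proof -
  let ?s = "\<lambda>f w. Poly_Mapping.single w (Poly_Mapping.lookup f w)"
  have single: "feval \<theta> (Poly_Mapping.single u c * Poly_Mapping.single v d)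
      = feval \<theta> (Poly_Mapping.single u c) * feval \<theta> (Poly_Mapping.single v d)" for u v c d
    by (simp add: mult_single feval_single mult plus_free_mon_def mult.assoc)
       (metis central mult.assoc)
  have "feval \<theta> (f * g)
      = feval \<theta> (\<Sum>u\<in>Poly_Mapping.keys f. \<Sum>v\<in>Poly_Mapping.keys g. ?s f u * ?s g v)"
    by (subst free_alg_expand[of f], subst free_alg_expand[of g]) (simp add: sum_product)
  also have "\<dots> = feval \<theta> (\<Sum>u\<in>Poly_Mapping.keys f. ?s f u) * feval \<theta> (\<Sum>v\<in>Poly_Mapping.keys g. ?s g v)"
    by (simp add: feval_sum single sum_product)
  finally show ?thesis
    by (simp flip: free_alg_expand)
qed

lemma feval_smult: "feval \<theta> (smult_free c f) = \<kappa> c * feval \<theta> f"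
  using feval_mult[of \<theta> "Poly_Mapping.single 0 c" f]
  by (simp add: smult_free_conv_single feval_single zero_free_mon_def)

text \<open>Universal property of the free algebra. It identifies composites, such as an
  endomorphism followed by an evaluation, with a single evaluation.\<close>

lemma feval_unique:
  assumes "\<And>f g. H (f + g) = H f + H g" and "\<And>c f. H (smult_free c f) = \<kappa> c * H f"
    and "H 1 = 1" and "\<And>f g. H (f * g) = H f * H g"
  shows "H f = feval (\<lambda>x. H (gen x)) f"
  by (induction f rule: free_alg_induct)
     (simp_all add: assms feval_add feval_smult feval_mult)

end

lemma scalars_free: "scalars (Poly_Mapping.single 0 :: 'a::field \<Rightarrow> 'a free_alg)"
proof
  fix c :: 'a and f :: "'a free_alg"
  show "Poly_Mapping.single 0 c * f = f * Poly_Mapping.single 0 c"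
    using smult_free_mult_right[of f c 1] by (simp add: smult_free_conv_single)
qed (simp_all add: single_add mult_single)

interpretation fsubst: scalars "Poly_Mapping.single 0 :: 'a::field \<Rightarrow> 'a free_alg"
  by (rule scalars_free)

lemma feval_star_endo:
  fixes \<theta> :: "var \<Rightarrow> 'a::field free_alg"
  assumes "\<And>i. star (\<theta> (Y i)) = \<theta> (Y i)" and "\<And>i. star (\<theta> (Z i)) = - \<theta> (Z i)"
  shows "star_endo (fsubst.feval \<theta>)"
proof -
  have gen: "fsubst.feval \<theta> (star (gen x)) = star (fsubst.feval \<theta> (gen x))" for x
    by (cases x) (simp_all add: assms fsubst.feval_uminus)
  have "fsubst.feval \<theta> (star f) = star (fsubst.feval \<theta> f)" for f
    by (induction f rule: free_alg_induct)
       (simp_all add: star_add star_smult star_mult gen fsubst.feval_add fsubst.feval_mult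
         fsubst.feval_smult flip: smult_free_conv_single)
  then show ?thesis
    unfolding star_endo_def
    by (simp add: fsubst.feval_add fsubst.feval_mult fsubst.feval_smult flip: smult_free_conv_single)
qed

section \<open>Commutative polynomials\<close>

type_synonym ('p, 'a) mpoly = "'p multiset \<Rightarrow>\<^sub>0 'a"

text \<open>Two uses: multiplicative \<open>g\<close> gives evaluation at a point,
  \<open>insertion\<close>; a contraction as \<open>g\<close> gives the inverse of an entry of the
  generic element.\<close>

definition mon_extend :: "('p multiset \<Rightarrow> 'a) \<Rightarrow> ('p, 'a::field) mpoly \<Rightarrow> 'a" where
  "mon_extend g p = (\<Sum>M\<in>Poly_Mapping.keys p. Poly_Mapping.lookup p M * g M)"

lemma mon_extend_superset:
  assumes "finite S" and "Poly_Mapping.keys p \<subseteq> S"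
  shows "mon_extend g p = (\<Sum>M\<in>S. Poly_Mapping.lookup p M * g M)"
  unfolding mon_extend_def by (rule sum.mono_neutral_left) (use assms in \<open>auto simp: in_keys_iff\<close>)

lemma mon_extend_zero [simp]: "mon_extend g 0 = 0"
  by (simp add: mon_extend_def)

lemma mon_extend_single [simp]: "mon_extend g (Poly_Mapping.single M c) = c * g M"
  by (subst mon_extend_superset[of "{M}"]) auto

lemma mon_extend_add: "mon_extend g (p + q) = mon_extend g p + mon_extend g q"
proof -
  let ?S = "Poly_Mapping.keys p \<union> Poly_Mapping.keys q"
  have "mon_extend g r = (\<Sum>M\<in>?S. Poly_Mapping.lookup r M * g M)" if "r \<in> {p, q, p + q}" for r
    by (rule mon_extend_superset) (use that in \<open>auto simp: in_keys_iff lookup_add\<close>)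
  then show ?thesis
    by (simp add: lookup_add distrib_right sum.distrib)
qed

lemma mon_extend_uminus: "mon_extend g (- p) = - mon_extend g p"
  using mon_extend_add[of g p "- p"] by (simp add: eq_neg_iff_add_eq_0 add.commute)

lemma mon_extend_diff: "mon_extend g (p - q) = mon_extend g p - mon_extend g q"
  using mon_extend_add[of g p "- q"] by (simp add: mon_extend_uminus)

lemma mon_extend_sum: "mon_extend g (sum p S) = (\<Sum>x\<in>S. mon_extend g (p x))"
  by (induction S rule: infinite_finite_induct) (simp_all add: mon_extend_add)

lemma mon_extend_scale: "mon_extend g (Poly_Mapping.single 0 c * p) = c * mon_extend g p"
proof -
  have "mon_extend g (Poly_Mapping.single 0 c * (\<Sum>M\<in>Poly_Mapping.keys p.
      Poly_Mapping.single M (Poly_Mapping.lookup p M)))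
      = (\<Sum>M\<in>Poly_Mapping.keys p. c * Poly_Mapping.lookup p M * g M)"
    by (simp add: sum_distrib_left mult_single mon_extend_sum)
  also have "\<dots> = c * mon_extend g p"
    by (simp add: mon_extend_def sum_distrib_left mult.assoc)
  finally show ?thesis
    by (simp flip: free_alg_expand)
qed

definition insertion :: "('p \<Rightarrow> 'a::field) \<Rightarrow> ('p, 'a) mpoly \<Rightarrow> 'a" where
  "insertion \<theta> = mon_extend (\<lambda>M. prod_mset (image_mset \<theta> M))"

lemma insertion_single: "insertion \<theta> (Poly_Mapping.single M c) = c * prod_mset (image_mset \<theta> M)"
  by (simp add: insertion_def)

lemma insertion_zero [simp]: "insertion \<theta> 0 = 0"
  and insertion_add: "insertion \<theta> (p + q) = insertion \<theta> p + insertion \<theta> q"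
  and insertion_uminus: "insertion \<theta> (- p) = - insertion \<theta> p"
  by (simp_all add: insertion_def mon_extend_add mon_extend_uminus)

lemma insertion_one [simp]: "insertion \<theta> 1 = 1"
  using insertion_single[of \<theta> 0 1] by simp

lemma insertion_mult: "insertion \<theta> (p * q) = insertion \<theta> p * insertion \<theta> q"
proof -
  let ?s = "\<lambda>p M. Poly_Mapping.single M (Poly_Mapping.lookup p M)"
  have single: "insertion \<theta> (Poly_Mapping.single M c * Poly_Mapping.single N d)
      = insertion \<theta> (Poly_Mapping.single M c) * insertion \<theta> (Poly_Mapping.single N d)" for M N c d
    by (simp add: mult_single insertion_single)
  have "insertion \<theta> ((\<Sum>M\<in>Poly_Mapping.keys p. ?s p M) * (\<Sum>M\<in>Poly_Mapping.keys q. ?s q M))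
      = insertion \<theta> (\<Sum>M\<in>Poly_Mapping.keys p. ?s p M) * insertion \<theta> (\<Sum>M\<in>Poly_Mapping.keys q. ?s q M)"
    by (simp only: insertion_def sum_product mon_extend_sum single[unfolded insertion_def])
  then show ?thesis
    by (simp flip: free_alg_expand)
qed

text \<open>Dedekind's independence of characters: multisets are the monomials, and distinct monomials
  are separated by doubling one coordinate.\<close>

lemma monomials_independent:
  fixes c :: "'p multiset \<Rightarrow> 'a::field_char_0"
  assumes "finite S" and "\<And>\<theta>. (\<Sum>M\<in>S. c M * prod_mset (image_mset \<theta> M)) = 0" and "M \<in> S"
  shows "c M = 0"
  using assms
proof (induction S arbitrary: c M rule: finite_induct)
  case (insert N S)
  let ?\<chi> = "\<lambda>\<theta> M. prod_mset (image_mset \<theta> M) :: 'a"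
  have mult: "?\<chi> (\<lambda>p. \<theta> p * \<eta> p) M = ?\<chi> \<theta> M * ?\<chi> \<eta> M" for \<theta> \<eta> :: "'p \<Rightarrow> 'a" and M
    by (rule prod_mset.distrib)
  have S: "c M = 0" if "M \<in> S" for M
  proof -
    have "M \<noteq> N"
      using insert that by blast
    then obtain p where p: "count M p \<noteq> count N p"
      by (auto simp: multiset_eq_iff)
    define \<eta> where "\<eta> = (\<lambda>q. if q = p then 2 else 1 :: 'a)"
    have \<eta>: "?\<chi> \<eta> M = 2 ^ count M p" for M
      by (induction M) (simp_all add: \<eta>_def)
    \<comment> \<open>The relation at the product of \<theta> and \<eta>, minus the value of \<eta>
      on \<open>N\<close> times the relation at \<theta>, no longer contains
      \<open>N\<close>.\<close>
    have "(\<Sum>M\<in>S. (c M * (?\<chi> \<eta> M - ?\<chi> \<eta> N)) * ?\<chi> \<theta> M) = 0" for \<theta>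
    proof -
      have "(\<Sum>M\<in>S. (c M * (?\<chi> \<eta> M - ?\<chi> \<eta> N)) * ?\<chi> \<theta> M)
          = (\<Sum>M\<in>insert N S. (c M * (?\<chi> \<eta> M - ?\<chi> \<eta> N)) * ?\<chi> \<theta> M)"
        using insert by simp
      also have "\<dots> = (\<Sum>M\<in>insert N S. c M * ?\<chi> (\<lambda>p. \<theta> p * \<eta> p) M)
          - ?\<chi> \<eta> N * (\<Sum>M\<in>insert N S. c M * ?\<chi> \<theta> M)"
        unfolding mult by (simp add: sum_distrib_left sum_subtractf algebra_simps)
      also have "\<dots> = 0"
        using insert.prems(1) by simp
      finally show ?thesis .
    qed
    then have "c M * (?\<chi> \<eta> M - ?\<chi> \<eta> N) = 0"
      using insert.IH[of "\<lambda>M. c M * (?\<chi> \<eta> M - ?\<chi> \<eta> N)"] that by blast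
    moreover have "(2::'a) ^ m \<noteq> 2 ^ n" if "m \<noteq> n" for m n :: nat
    proof -
      have "of_nat (2 ^ m) \<noteq> (of_nat (2 ^ n) :: 'a)"
        unfolding of_nat_eq_iff using that by simp
      then show ?thesis
        by simp
    qed
    ultimately show ?thesis
      using p by (simp add: \<eta>)
  qed
  have "c N * ?\<chi> (\<lambda>_. 1) N = 0"
    using insert.prems(1)[of "\<lambda>_. 1"] insert.hyps S by simp
  then have "c N = 0"
    by simp
  then show ?case
    using S insert.prems(2) by blast
qed simp

lemma mpoly_eq_0_if_insertion:
  fixes p :: "('p, 'a::field_char_0) mpoly"
  assumes "\<And>\<theta>. insertion \<theta> p = 0"
  shows "p = 0"
proof -
  have "Poly_Mapping.lookup p M = 0" if "M \<in> Poly_Mapping.keys p" for M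
    by (rule monomials_independent[OF _ _ that])
       (use assms in \<open>simp_all add: insertion_def mon_extend_def\<close>)
  then show ?thesis
    by (auto simp flip: keys_eq_empty simp: in_keys_iff)
qed


section \<open>The block algebra over a commutative ring\<close>

text \<open>Entry (2,3) is absent because the upper right block is triangular. As a type, rather
  than a set of matrices with a carrier, this is an instance of \<open>ring_1\<close> over every
  commutative ring, in particular over polynomials.\<close>

datatype 'b blk = Blk (e11: 'b) (e12: 'b) (e13: 'b) (e14: 'b) (e22: 'b) (e24: 'b) (e33: 'b)
  (e34: 'b) (e44: 'b)

instantiation blk :: (comm_ring_1) ring_1
begin

definition zero_blk :: "'a blk" where
  "0 = Blk 0 0 0 0 0 0 0 0 0"

definition one_blk :: "'a blk" where
  "1 = Blk 1 0 0 0 1 0 1 0 1"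

definition plus_blk :: "'a blk \<Rightarrow> 'a blk \<Rightarrow> 'a blk" where
  "a + b = Blk (e11 a + e11 b) (e12 a + e12 b) (e13 a + e13 b) (e14 a + e14 b) (e22 a + e22 b)
     (e24 a + e24 b) (e33 a + e33 b) (e34 a + e34 b) (e44 a + e44 b)"

definition uminus_blk :: "'a blk \<Rightarrow> 'a blk" where
  "- a = Blk (- e11 a) (- e12 a) (- e13 a) (- e14 a) (- e22 a) (- e24 a) (- e33 a) (- e34 a)
     (- e44 a)"

definition minus_blk :: "'a blk \<Rightarrow> 'a blk \<Rightarrow> 'a blk" where
  "a - b = Blk (e11 a - e11 b) (e12 a - e12 b) (e13 a - e13 b) (e14 a - e14 b) (e22 a - e22 b)
     (e24 a - e24 b) (e33 a - e33 b) (e34 a - e34 b) (e44 a - e44 b)"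

definition times_blk :: "'a blk \<Rightarrow> 'a blk \<Rightarrow> 'a blk" where
  "a * b = Blk (e11 a * e11 b) (e11 a * e12 b + e12 a * e22 b) (e11 a * e13 b + e13 a * e33 b)
     (e11 a * e14 b + e12 a * e24 b + e13 a * e34 b + e14 a * e44 b) (e22 a * e22 b)
     (e22 a * e24 b + e24 a * e44 b) (e33 a * e33 b) (e33 a * e34 b + e34 a * e44 b)
     (e44 a * e44 b)"

instance
  by standard (auto simp: zero_blk_def one_blk_def plus_blk_def uminus_blk_def minus_blk_def
      times_blk_def algebra_simps)

end

lemma blk_sel_zero [simp]:
  "e11 0 = 0" "e12 0 = 0" "e13 0 = 0" "e14 0 = 0" "e22 0 = 0" "e24 0 = 0" "e33 0 = 0"
  "e34 0 = 0" "e44 0 = 0"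
  by (simp_all add: zero_blk_def)

lemma blk_sel_one [simp]:
  "e11 1 = 1" "e12 1 = 0" "e13 1 = 0" "e14 1 = 0" "e22 1 = 1" "e24 1 = 0" "e33 1 = 1"
  "e34 1 = 0" "e44 1 = 1"
  by (simp_all add: one_blk_def)

lemma blk_sel_plus [simp]:
  "e11 (a + b) = e11 a + e11 b" "e12 (a + b) = e12 a + e12 b" "e13 (a + b) = e13 a + e13 b"
  "e14 (a + b) = e14 a + e14 b" "e22 (a + b) = e22 a + e22 b" "e24 (a + b) = e24 a + e24 b"
  "e33 (a + b) = e33 a + e33 b" "e34 (a + b) = e34 a + e34 b" "e44 (a + b) = e44 a + e44 b"
  by (simp_all add: plus_blk_def)

lemma blk_sel_minus [simp]:
  "e11 (a - b) = e11 a - e11 b" "e12 (a - b) = e12 a - e12 b" "e13 (a - b) = e13 a - e13 b"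
  "e14 (a - b) = e14 a - e14 b" "e22 (a - b) = e22 a - e22 b" "e24 (a - b) = e24 a - e24 b"
  "e33 (a - b) = e33 a - e33 b" "e34 (a - b) = e34 a - e34 b" "e44 (a - b) = e44 a - e44 b"
  by (simp_all add: minus_blk_def)

lemma blk_sel_uminus [simp]:
  "e11 (- a) = - e11 a" "e12 (- a) = - e12 a" "e13 (- a) = - e13 a" "e14 (- a) = - e14 a"
  "e22 (- a) = - e22 a" "e24 (- a) = - e24 a" "e33 (- a) = - e33 a" "e34 (- a) = - e34 a"
  "e44 (- a) = - e44 a"
  by (simp_all add: uminus_blk_def)

lemma blk_sel_times [simp]:
  "e11 (a * b) = e11 a * e11 b"
  "e12 (a * b) = e11 a * e12 b + e12 a * e22 b"
  "e13 (a * b) = e11 a * e13 b + e13 a * e33 b"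
  "e14 (a * b) = e11 a * e14 b + e12 a * e24 b + e13 a * e34 b + e14 a * e44 b"
  "e22 (a * b) = e22 a * e22 b"
  "e24 (a * b) = e22 a * e24 b + e24 a * e44 b"
  "e33 (a * b) = e33 a * e33 b"
  "e34 (a * b) = e33 a * e34 b + e34 a * e44 b"
  "e44 (a * b) = e44 a * e44 b"
  by (simp_all add: times_blk_def)

text \<open>Position (i,j) goes to (5-j,5-i). Among the nine entries only (1,4) stays in place,
  which is what makes the values of products of two commutators symmetric.\<close>

definition bstar :: "'b blk \<Rightarrow> 'b blk" where
  "bstar a = Blk (e44 a) (e34 a) (e24 a) (e14 a) (e33 a) (e13 a) (e22 a) (e12 a) (e11 a)"

lemma blk_sel_bstar [simp]:
  "e11 (bstar a) = e44 a" "e12 (bstar a) = e34 a" "e13 (bstar a) = e24 a" "e14 (bstar a) = e14 a"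
  "e22 (bstar a) = e33 a" "e24 (bstar a) = e13 a" "e33 (bstar a) = e22 a" "e34 (bstar a) = e12 a"
  "e44 (bstar a) = e11 a"
  by (simp_all add: bstar_def)

lemma bstar_add: "bstar (a + b) = bstar a + bstar b"
  and bstar_mult: "bstar (a * b) = bstar b * bstar a"
  and bstar_one: "bstar 1 = (1 :: 'b::comm_ring_1 blk)"
  for a b :: "'b::comm_ring_1 blk"
  by (auto intro!: blk.expand simp: algebra_simps)

definition bscal :: "'b::zero \<Rightarrow> 'b blk" where
  "bscal c = Blk c 0 0 0 c 0 c 0 c"

lemma blk_sel_bscal [simp]:
  "e11 (bscal c) = c" "e12 (bscal c) = 0" "e13 (bscal c) = 0" "e14 (bscal c) = 0"
  "e22 (bscal c) = c" "e24 (bscal c) = 0" "e33 (bscal c) = c" "e34 (bscal c) = 0"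
  "e44 (bscal c) = c"
  by (simp_all add: bscal_def)

locale comm_scalars = scalars \<kappa> for \<kappa> :: "'a::field \<Rightarrow> 'b::comm_ring_1"

sublocale comm_scalars \<subseteq> blk: scalars "\<lambda>c. bscal (\<kappa> c)"
  by standard (auto intro!: blk.expand simp: zero one add mult mult.commute)

definition star_compatible :: "(var \<Rightarrow> 'b::comm_ring_1 blk) \<Rightarrow> bool" where
  "star_compatible \<theta> \<longleftrightarrow> (\<forall>i. bstar (\<theta> (Y i)) = \<theta> (Y i)) \<and> (\<forall>i. bstar (\<theta> (Z i)) = - \<theta> (Z i))"

lemma (in comm_scalars) feval_star:
  assumes "star_compatible \<theta>"
  shows "blk.feval \<theta> (star f) = bstar (blk.feval \<theta> f)"
proof (induction f rule: free_alg_induct)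
  case (scale c f)
  have "bscal d * bstar b = bstar (bscal d * b)" for d :: 'b and b
    by (auto intro!: blk.expand)
  with scale show ?case
    by (simp add: star_smult blk.feval_smult)
next
  case (gen x f)
  have "blk.feval \<theta> (star (gen x)) = bstar (\<theta> x)"
    using assms by (cases x) (simp_all add: star_compatible_def blk.feval_uminus)
  with gen show ?case
    by (simp add: star_mult blk.feval_mult bstar_mult)
qed (simp_all add: star_add blk.feval_add bstar_add bstar_one)

interpretation sc: comm_scalars "\<lambda>c :: 'a::field. c"
  by standard simp_all

interpretation pc: comm_scalars "Poly_Mapping.single 0 :: 'a::field \<Rightarrow> ('p, 'a) mpoly"
  by standard (simp_all add: single_add mult_single mult.commute)

lemma feval_specialize:
  fixes \<theta> :: "var \<Rightarrow> ('p, 'a::field) mpoly blk"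
  shows "map_blk (insertion \<eta>) (pc.blk.feval \<theta> f) = sc.blk.feval (\<lambda>x. map_blk (insertion \<eta>) (\<theta> x)) f"
proof -
  have "map_blk (insertion \<eta>) (pc.blk.feval \<theta> f)
      = sc.blk.feval (\<lambda>x. map_blk (insertion \<eta>) (pc.blk.feval \<theta> (gen x))) f"
    by (rule sc.blk.feval_unique)
       (auto intro!: blk.expand simp: pc.blk.feval_add pc.blk.feval_mult pc.blk.feval_smult
          insertion_add insertion_mult insertion_single blk.map_sel)
  then show ?thesis
    by simp
qed

lemma star_compatible_specialize:
  assumes "star_compatible \<theta>"
  shows "star_compatible (\<lambda>x. map_blk (insertion \<eta>) (\<theta> x))"
proof -
  have "bstar (map_blk (insertion \<eta>) b) = map_blk (insertion \<eta>) (bstar b)"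
    "- map_blk (insertion \<eta>) b = map_blk (insertion \<eta>) (- b)" for b
    by (auto intro!: blk.expand simp: blk.map_sel insertion_uminus)
  with assms show ?thesis
    by (simp add: star_compatible_def)
qed


section \<open>Matrices\<close>

definition blk_entry :: "'a::zero blk \<Rightarrow> nat \<Rightarrow> nat \<Rightarrow> 'a" where
  "blk_entry b i j = (case (i, j) of
     (0, 0) \<Rightarrow> e11 b | (0, Suc 0) \<Rightarrow> e12 b | (0, Suc (Suc 0)) \<Rightarrow> e13 b
   | (0, Suc (Suc (Suc 0))) \<Rightarrow> e14 b | (Suc 0, Suc 0) \<Rightarrow> e22 b
   | (Suc 0, Suc (Suc (Suc 0))) \<Rightarrow> e24 b | (Suc (Suc 0), Suc (Suc 0)) \<Rightarrow> e33 b
   | (Suc (Suc 0), Suc (Suc (Suc 0))) \<Rightarrow> e34 b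
   | (Suc (Suc (Suc 0)), Suc (Suc (Suc 0))) \<Rightarrow> e44 b
   | _ \<Rightarrow> 0)"

definition mat_of_blk :: "'a::zero blk \<Rightarrow> 'a mat" where
  "mat_of_blk b = mat 4 4 (\<lambda>(i, j). blk_entry b i j)"

lemma mat_of_blk_carrier [simp]: "mat_of_blk b \<in> carrier_mat 4 4"
  by (simp add: mat_of_blk_def)

lemma mat_of_blk_dims [simp]: "dim_row (mat_of_blk b) = 4" "dim_col (mat_of_blk b) = 4"
  by (simp_all add: mat_of_blk_def)

lemma less_4_cases: "i < 4 \<Longrightarrow> i = 0 \<or> i = Suc 0 \<or> i = Suc (Suc 0) \<or> i = Suc (Suc (Suc 0))"
  for i :: nat
  by auto

lemma sum_upto_4: "sum f {0..<4} = f 0 + f (Suc 0) + f (Suc (Suc 0)) + f (Suc (Suc (Suc 0)))"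
  for f :: "nat \<Rightarrow> 'a::comm_monoid_add"
  by (simp add: numeral_eq_Suc add.assoc)

lemma mat_4_eqI:
  assumes "A \<in> carrier_mat 4 4" and "B \<in> carrier_mat 4 4"
    and "\<And>i j. i \<in> {0, Suc 0, Suc (Suc 0), Suc (Suc (Suc 0))} \<Longrightarrow>
      j \<in> {0, Suc 0, Suc (Suc 0), Suc (Suc (Suc 0))} \<Longrightarrow> A $$ (i, j) = B $$ (i, j)"
  shows "A = B"
  using assms by (intro eq_matI) (auto dest!: less_4_cases)

lemma mat_of_blk_mult: "mat_of_blk (a * b) = mat_of_blk a * mat_of_blk b"
  for a b :: "'a::comm_ring_1 blk"
  by (rule mat_4_eqI)
     (auto simp: mat_of_blk_def scalar_prod_def sum_upto_4 blk_entry_def)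

lemma mat_of_blk_one: "mat_of_blk 1 = (1\<^sub>m 4 :: 'a::comm_ring_1 mat)"
  by (rule mat_4_eqI) (auto simp: mat_of_blk_def blk_entry_def)

lemma mat_of_blk_zero: "mat_of_blk 0 = (0\<^sub>m 4 4 :: 'a::comm_ring_1 mat)"
  by (rule mat_4_eqI) (auto simp: mat_of_blk_def blk_entry_def)

lemma mat_of_blk_add: "mat_of_blk (a + b) = mat_of_blk a + mat_of_blk b"
  and mat_of_blk_uminus: "mat_of_blk (- a) = - mat_of_blk a"
  and mat_of_blk_scale: "mat_of_blk (bscal c * a) = c \<cdot>\<^sub>m mat_of_blk a"
  for a b :: "'a::comm_ring_1 blk"
  by (rule mat_4_eqI; auto simp: mat_of_blk_def blk_entry_def)+

lemma inj_mat_of_blk: "mat_of_blk a = mat_of_blk b \<longleftrightarrow> a = b"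
proof
  assume "mat_of_blk a = mat_of_blk b"
  then have *: "blk_entry a i j = blk_entry b i j" if "i < 4" "j < 4" for i j
    using that by (auto simp: mat_of_blk_def dest!: arg_cong[where f = "\<lambda>A. A $$ (i, j)"])
  show "a = b"
    using *[of 0 0] *[of 0 "Suc 0"] *[of 0 "Suc (Suc 0)"] *[of 0 "Suc (Suc (Suc 0))"]
      *[of "Suc 0" "Suc 0"] *[of "Suc 0" "Suc (Suc (Suc 0))"] *[of "Suc (Suc 0)" "Suc (Suc 0)"]
      *[of "Suc (Suc 0)" "Suc (Suc (Suc 0))"] *[of "Suc (Suc (Suc 0))" "Suc (Suc (Suc 0))"]
    by (intro blk.expand) (simp add: blk_entry_def)
qed simp

lemma reflection_mat_of_blk: "reflection 4 (mat_of_blk b) = mat_of_blk (bstar b)"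
  for b :: "'a::field blk"
  unfolding reflection_def antidiag_mat_def
  by (rule mat_4_eqI)
     (auto simp: mat_of_blk_def scalar_prod_def sum_upto_4 blk_entry_def)

lemma block_alg_eq_range: "block_alg = range (mat_of_blk :: 'a::field blk \<Rightarrow> 'a mat)"
proof (intro subset_antisym subsetI)
  fix M :: "'a mat"
  assume "M \<in> block_alg"
  then obtain A B C where M: "M = four_block_mat A C (0\<^sub>m 2 2) B"
    and ABC: "A \<in> UT 2" "B \<in> UT 2" "C \<in> UT 2"
    by (auto simp: block_alg_def)
  from ABC have dim: "A \<in> carrier_mat 2 2" "B \<in> carrier_mat 2 2" "C \<in> carrier_mat 2 2"
    by (auto simp: UT_def)
  from ABC have "A $$ (Suc 0, 0) = 0" "B $$ (Suc 0, 0) = 0" "C $$ (Suc 0, 0) = 0"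
    by (auto simp: UT_def)
  with dim have "M = mat_of_blk (Blk (A $$ (0, 0)) (A $$ (0, 1)) (C $$ (0, 0)) (C $$ (0, 1))
    (A $$ (1, 1)) (C $$ (1, 1)) (B $$ (0, 0)) (B $$ (0, 1)) (B $$ (1, 1)))"
    unfolding M by (intro mat_4_eqI) (auto simp: mat_of_blk_def blk_entry_def)
  then show "M \<in> range mat_of_blk"
    by blast
next
  fix M :: "'a mat"
  assume "M \<in> range mat_of_blk"
  then obtain b where b: "M = mat_of_blk b"
    by blast
  define T where "T x y z = mat 2 2 (\<lambda>(i, j). if i = 0 then if j = 0 then x else y
    else if j = 0 then 0 else z)" for x y z :: 'a
  have T: "T x y z \<in> UT 2" for x y z
    by (auto simp: T_def UT_def upper_triangular_def)
  have "M = four_block_mat (T (e11 b) (e12 b) (e22 b)) (T (e13 b) (e14 b) (e24 b)) (0\<^sub>m 2 2)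
    (T (e33 b) (e34 b) (e44 b))"
    unfolding b by (intro mat_4_eqI) (auto simp: mat_of_blk_def T_def blk_entry_def)
  with T show "M \<in> block_alg"
    unfolding block_alg_def by blast
qed

lemma sym_part_eq: "sym_part = mat_of_blk ` {b :: 'a::field blk. bstar b = b}"
  and skew_part_eq: "skew_part = mat_of_blk ` {b :: 'a::field blk. bstar b = - b}"
  by (auto simp: sym_part_def skew_part_def block_alg_eq_range reflection_mat_of_blk
      inj_mat_of_blk simp flip: mat_of_blk_uminus)

lemma eval_word_mat_of_blk:
  "eval_word (\<lambda>x. mat_of_blk (\<theta> x)) w = mat_of_blk (prod_list (map \<theta> (letters w)))"
  for \<theta> :: "var \<Rightarrow> 'a::field blk"
proof -
  have "foldr (\<lambda>x M. mat_of_blk (\<theta> x) * M) xs (1\<^sub>m 4) = mat_of_blk (prod_list (map \<theta> xs))" for xs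
    by (induction xs) (simp_all add: mat_of_blk_one mat_of_blk_mult)
  then show ?thesis
    by (simp add: eval_word_def)
qed

lemma finsum_mat_of_blk:
  fixes g :: "'i \<Rightarrow> 'a::field blk"
  assumes "finite S"
  shows "finsum (ring_mat TYPE('a) 4 ()) (\<lambda>w. mat_of_blk (g w)) S = mat_of_blk (sum g S)"
proof -
  interpret R: ring "ring_mat TYPE('a) 4 ()"
    by (rule ring_mat)
  show ?thesis
    using assms
  proof (induction S rule: finite_induct)
    case (insert x S)
    then show ?case
      by (subst R.finsum_insert) (auto simp: ring_mat_simps mat_of_blk_add)
  qed (simp add: R.finsum_empty mat_of_blk_zero ring_mat_simps)
qed

lemma eval_free_mat_of_blk:
  "eval_free (\<lambda>x. mat_of_blk (\<theta> x)) f = mat_of_blk (sc.blk.feval \<theta> f)"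
  for \<theta> :: "var \<Rightarrow> 'a::field blk"
  unfolding eval_free_def eval_word_mat_of_blk sc.blk.feval_def
  by (subst finsum_mat_of_blk[symmetric]) (simp_all add: mat_of_blk_scale)

text \<open>The bridge between the carrier-based matrices of the statement and the type
  \<open>blk\<close>, in which the remaining arguments take place.\<close>

lemma star_identities_iff:
  "f \<in> star_identities \<longleftrightarrow> (\<forall>\<theta>. star_compatible \<theta> \<longrightarrow> sc.blk.feval \<theta> f = 0)"
  for f :: "'a::field free_alg"
proof
  assume f: "f \<in> star_identities"
  show "\<forall>\<theta>. star_compatible \<theta> \<longrightarrow> sc.blk.feval \<theta> f = 0"
  proof (intro allI impI)
    fix \<theta> :: "var \<Rightarrow> 'a blk"
    assume "star_compatible \<theta>"
    then have "eval_free (\<lambda>x. mat_of_blk (\<theta> x)) f = 0\<^sub>m 4 4"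
      using f by (auto simp: star_identities_def star_compatible_def sym_part_eq skew_part_eq)
    then show "sc.blk.feval \<theta> f = 0"
      by (simp add: eval_free_mat_of_blk inj_mat_of_blk flip: mat_of_blk_zero)
  qed
next
  assume f: "\<forall>\<theta>. star_compatible \<theta> \<longrightarrow> sc.blk.feval \<theta> f = 0"
  have "eval_free \<sigma> f = 0\<^sub>m 4 4"
    if \<sigma>: "\<And>i. \<sigma> (Y i) \<in> sym_part" "\<And>i. \<sigma> (Z i) \<in> skew_part" for \<sigma>
  proof -
    have "\<exists>b. \<sigma> x = mat_of_blk b \<and> bstar b = (case x of Y i \<Rightarrow> b | Z i \<Rightarrow> - b)" for x
      using \<sigma> by (cases x) (force simp: sym_part_eq skew_part_eq)+
    then obtain \<theta> where \<theta>: "\<And>x. \<sigma> x = mat_of_blk (\<theta> x)"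
      "\<And>x. bstar (\<theta> x) = (case x of Y i \<Rightarrow> \<theta> x | Z i \<Rightarrow> - \<theta> x)"
      by metis
    then have "star_compatible \<theta>"
      by (simp add: star_compatible_def)
    moreover have "\<sigma> = (\<lambda>x. mat_of_blk (\<theta> x))"
      using \<theta>(1) by blast
    ultimately show ?thesis
      using f by (simp add: eval_free_mat_of_blk mat_of_blk_zero)
  qed
  then show "f \<in> star_identities"
    by (auto simp: star_identities_def)
qed

text \<open>Every specialization of the parameters is an admissible substitution, on which
  \<open>f\<close> vanishes, and a polynomial over an infinite field that vanishes at all points is
  zero.\<close>

lemma generic_feval_eq_0:
  fixes f :: "'a::field_char_0 free_alg" and \<theta> :: "var \<Rightarrow> ('p, 'a) mpoly blk"
  assumes "f \<in> star_identities" and "star_compatible \<theta>"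
  shows "pc.blk.feval \<theta> f = 0"
proof -
  have *: "map_blk (insertion \<eta>) (pc.blk.feval \<theta> f) = 0" for \<eta>
    using assms by (simp add: feval_specialize star_compatible_specialize star_identities_iff)
  have "s (pc.blk.feval \<theta> f) = 0"
    if "\<And>\<eta>. insertion \<eta> (s (pc.blk.feval \<theta> f)) = 0" for s :: "('p, 'a) mpoly blk \<Rightarrow> ('p, 'a) mpoly"
    using that by (rule mpoly_eq_0_if_insertion)
  from this[of e11] this[of e12] this[of e13] this[of e14] this[of e22] this[of e24] this[of e33]
    this[of e34] this[of e44] show ?thesis
    using *[THEN arg_cong, of e11] *[THEN arg_cong, of e12] *[THEN arg_cong, of e13]
      *[THEN arg_cong, of e14] *[THEN arg_cong, of e22] *[THEN arg_cong, of e24]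
      *[THEN arg_cong, of e33] *[THEN arg_cong, of e34] *[THEN arg_cong, of e44]
    by (intro blk.expand) (simp add: blk.map_sel)
qed

section \<open>Soundness of the generators\<close>

definition strictly_upper :: "'b::zero blk \<Rightarrow> bool" where
  "strictly_upper b \<longleftrightarrow> e11 b = 0 \<and> e22 b = 0 \<and> e33 b = 0 \<and> e44 b = 0"

lemma (in comm_scalars) strictly_upper_bracket: "strictly_upper (blk.feval \<theta> (bracket f g))"
  by (simp add: bracket_def strictly_upper_def blk.feval_diff blk.feval_mult mult.commute)

lemma left_normed_snoc: "as \<noteq> [] \<Longrightarrow> left_normed (as @ [a]) = bracket (left_normed as) a"
  by (cases as) simp_all

lemma commutators_cases:
  assumes "v \<in> commutators"
  obtains f g where "v = bracket f g"
proof -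
  obtain as where as: "length as \<ge> 2" "v = left_normed as"
    using assms by (auto simp: commutators_def)
  then have "butlast as \<noteq> []"
    by (cases as rule: rev_cases) auto
  with as that show thesis
    by (metis append_butlast_last_id butlast.simps(1) left_normed_snoc)
qed

text \<open>Commutators are strictly upper triangular. As there is no entry (2,3), a product
  containing two of them lives in position (1,4) alone, which the reflection fixes, and one
  containing three is zero. Family (2) consists of differences between such a product and its image
  under \<open>star\<close>; family (3) is checked entry by entry.\<close>

lemma gens_sound: "gens1 \<union> gens2 \<union> gens3 \<subseteq> (star_identities :: 'a::field free_alg set)"
proof
  fix f :: "'a free_alg"
  assume f: "f \<in> gens1 \<union> gens2 \<union> gens3"
  have "sc.blk.feval \<theta> f = 0" if \<theta>: "star_compatible \<theta>" for \<theta>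
  proof -
    let ?e = "sc.blk.feval \<theta>"
    have su: "strictly_upper (?e v)" if "v \<in> commutators" for v
      using that by (elim commutators_cases) (simp add: sc.strictly_upper_bracket)
    consider "f \<in> gens1"
      | v1 v2 x where "v1 \<in> commutators" "v2 \<in> commutators"
          "f = v1 * gen x * v2 - star v2 * star (gen x) * star v1"
      | v1 v2 x where "v1 \<in> commutators" "v2 \<in> commutators"
          "f = v1 * v2 * gen x - star (gen x) * star v2 * star v1"
      | "f \<in> gens3"
      using f by (auto simp: gens2_def)
    then show ?thesis
    proof cases
      case 1
      then show ?thesis
        by (auto simp: gens1_def sc.blk.feval_mult strictly_upper_def intro!: blk.expand dest!: su)
    next
      case 2
      have "f = v1 * gen x * v2 - star (v1 * gen x * v2)"
        by (simp add: 2 star_mult mult.assoc)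
      then show ?thesis
        using su[OF 2(1)] su[OF 2(2)]
        by (auto simp: sc.blk.feval_diff sc.feval_star[OF \<theta>] sc.blk.feval_mult strictly_upper_def
            intro!: blk.expand)
    next
      case 3
      have "f = v1 * v2 * gen x - star (v1 * v2 * gen x)"
        by (simp add: 3 star_mult mult.assoc)
      then show ?thesis
        using su[OF 3(1)] su[OF 3(2)]
        by (auto simp: sc.blk.feval_diff sc.feval_star[OF \<theta>] sc.blk.feval_mult strictly_upper_def
            intro!: blk.expand)
    next
      case 4
      have "bstar (\<theta> (Y i)) = \<theta> (Y i)" for i
        using \<theta> by (simp add: star_compatible_def)
      then have sym: "e33 (\<theta> (Y i)) = e22 (\<theta> (Y i))" "e44 (\<theta> (Y i)) = e11 (\<theta> (Y i))"
        "e34 (\<theta> (Y i)) = e12 (\<theta> (Y i))" "e24 (\<theta> (Y i)) = e13 (\<theta> (Y i))" for i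
        by (metis blk_sel_bstar)+
      from 4 show ?thesis
        unfolding gens3_def Let_def
        by (elim insertE emptyE; hypsubst; intro blk.expand conjI;
            simp add: bracket_def sc.blk.feval_add sc.blk.feval_diff sc.blk.feval_mult sym;
            simp add: algebra_simps)
    qed
  qed
  then show "f \<in> star_identities"
    by (simp add: star_identities_iff)
qed

section \<open>Closure of the identities under substitution\<close>

lemma star_endo_add: "star_endo \<phi> \<Longrightarrow> \<phi> (f + g) = \<phi> f + \<phi> g"
  and star_endo_mult: "star_endo \<phi> \<Longrightarrow> \<phi> (f * g) = \<phi> f * \<phi> g"
  and star_endo_one: "star_endo \<phi> \<Longrightarrow> \<phi> 1 = 1"
  and star_endo_smult: "star_endo \<phi> \<Longrightarrow> \<phi> (smult_free c f) = smult_free c (\<phi> f)"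
  and star_endo_star: "star_endo \<phi> \<Longrightarrow> \<phi> (star f) = star (\<phi> f)"
  by (simp_all add: star_endo_def)

lemma star_endo_uminus: "star_endo \<phi> \<Longrightarrow> \<phi> (- f) = - \<phi> f"
  using star_endo_smult[of \<phi> "- 1" f] by (simp add: smult_free_minus_one)

lemma star_endo_diff: "star_endo \<phi> \<Longrightarrow> \<phi> (f - g) = \<phi> f - \<phi> g"
  using star_endo_add[of \<phi> f "- g"] by (simp add: star_endo_uminus)

text \<open>An endomorphism commuting with \<open>star\<close>, followed by an admissible
  evaluation, is again an admissible evaluation, given by its values on the generators.\<close>

lemma T_star_ideal_star_identities: "T_star_ideal (star_identities :: 'a::field free_alg set)"
proof -
  have "\<phi> f \<in> star_identities" if \<phi>: "star_endo \<phi>" and f: "f \<in> star_identities"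
    for \<phi> and f :: "'a free_alg"
    unfolding star_identities_iff
  proof (intro allI impI)
    fix \<theta> :: "var \<Rightarrow> 'a blk"
    assume \<theta>: "star_compatible \<theta>"
    define \<theta>' where "\<theta>' x = sc.blk.feval \<theta> (\<phi> (gen x))" for x
    have "sc.blk.feval \<theta> (\<phi> f) = sc.blk.feval \<theta>' f"
      unfolding \<theta>'_def
      by (rule sc.blk.feval_unique)
         (simp_all add: star_endo_add[OF \<phi>] star_endo_mult[OF \<phi>] star_endo_one[OF \<phi>]
           star_endo_smult[OF \<phi>] sc.blk.feval_add sc.blk.feval_mult sc.blk.feval_smult)
    moreover have "star_compatible \<theta>'"
      by (simp add: star_compatible_def \<theta>'_def flip: sc.feval_star[OF \<theta>] star_endo_star[OF \<phi>])
         (simp add: star_endo_uminus[OF \<phi>] sc.blk.feval_uminus)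
    ultimately show "sc.blk.feval \<theta> (\<phi> f) = 0"
      using f by (simp add: star_identities_iff)
  qed
  moreover have "bstar (0 :: 'a blk) = 0"
    by (auto intro!: blk.expand)
  ultimately show ?thesis
    by (auto simp: T_star_ideal_def two_sided_ideal_def star_identities_iff sc.blk.feval_add
        sc.blk.feval_mult sc.feval_star)
qed


section \<open>Two-sided ideals of the free algebra\<close>

lemma ideal_zero: "two_sided_ideal I \<Longrightarrow> 0 \<in> I"
  and ideal_add: "two_sided_ideal I \<Longrightarrow> f \<in> I \<Longrightarrow> g \<in> I \<Longrightarrow> f + g \<in> I"
  and ideal_left: "two_sided_ideal I \<Longrightarrow> f \<in> I \<Longrightarrow> g * f \<in> I"
  and ideal_right: "two_sided_ideal I \<Longrightarrow> f \<in> I \<Longrightarrow> f * g \<in> I"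
  by (auto simp: two_sided_ideal_def)

lemma ideal_smult: "two_sided_ideal I \<Longrightarrow> f \<in> I \<Longrightarrow> smult_free c f \<in> I"
  by (simp add: smult_free_conv_single ideal_left)

lemma ideal_uminus: "two_sided_ideal I \<Longrightarrow> f \<in> I \<Longrightarrow> - f \<in> I"
  using ideal_smult[of I f "- 1"] by (simp add: smult_free_minus_one)

lemma ideal_diff: "two_sided_ideal I \<Longrightarrow> f \<in> I \<Longrightarrow> g \<in> I \<Longrightarrow> f - g \<in> I"
  using ideal_add[of I f "- g"] by (simp add: ideal_uminus)

lemma ideal_bracket: "two_sided_ideal I \<Longrightarrow> f \<in> I \<Longrightarrow> bracket g f \<in> I"
  by (simp add: bracket_def ideal_diff ideal_left ideal_right)

lemma ideal_subspace: "two_sided_ideal I \<Longrightarrow> fa.subspace I"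
  by (simp add: fa.subspace_def ideal_zero ideal_add ideal_smult)

lemma span_linear_image:
  assumes "f \<in> fa.span S" and "\<And>s. s \<in> S \<Longrightarrow> L s \<in> J" and "fa.subspace J"
    and "\<And>f g. L (f + g) = L f + L g" and "\<And>c f. L (smult_free c f) = smult_free c (L f)"
  shows "L f \<in> J"
  using assms(1)
proof (induction rule: fa.span_induct_alt)
  case base
  have "L 0 = 0"
    using assms(5)[of 0 0] by simp
  then show ?case
    using assms(3) by (simp add: fa.subspace_0)
next
  case (step c s f)
  then show ?case
    using assms by (simp add: fa.subspace_add fa.subspace_scale)
qed

lemma two_sided_ideal_span:
  assumes "\<And>s x. s \<in> S \<Longrightarrow> gen x * s \<in> fa.span S" and "\<And>s x. s \<in> S \<Longrightarrow> s * gen x \<in> fa.span S"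
  shows "two_sided_ideal (fa.span S)"
proof -
  have left: "gen x * f \<in> fa.span S" and right: "f * gen x \<in> fa.span S"
    if "f \<in> fa.span S" for f x
    using that assms
    by (rule_tac [!] span_linear_image[where L = "\<lambda>f. gen x * f" for x, where S = S]
        span_linear_image[where L = "\<lambda>f. f * gen x" for x, where S = S];
        simp add: algebra_simps smult_free_mult_left smult_free_mult_right)+
  have "g * f \<in> fa.span S" if "f \<in> fa.span S" for f g
    by (induction g rule: free_alg_induct)
       (use that left in \<open>auto simp: algebra_simps smult_free_mult_left fa.span_add fa.span_scale mult.assoc\<close>)
  moreover have "f * g \<in> fa.span S" if "f \<in> fa.span S" for f g
    using that
    by (induction g arbitrary: f rule: free_alg_induct)
       (use right in \<open>auto simp: distrib_left smult_free_mult_right fa.span_add fa.span_scale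
          simp flip: mult.assoc\<close>)
  ultimately show ?thesis
    by (simp add: two_sided_ideal_def fa.span_zero fa.span_add)
qed

text \<open>By the Leibniz rule in each argument: commuting generators make the whole quotient by
  \<open>I\<close> commutative.\<close>

lemma bracket_mem_ideal:
  assumes I: "two_sided_ideal I" and gen: "\<And>x y. bracket (gen x) (gen y) \<in> I"
  shows "bracket f g \<in> I"
proof -
  have "bracket (gen x) g \<in> I" for x g
  proof (induction g rule: free_alg_induct)
    case (add f g)
    have "bracket (gen x) (f + g) = bracket (gen x) f + bracket (gen x) g"
      by (simp add: bracket_def algebra_simps)
    with add I show ?case
      by (simp add: ideal_add)
  next
    case (scale c f)
    have "bracket (gen x) (smult_free c f) = smult_free c (bracket (gen x) f)"
      by (simp add: bracket_def smult_free_mult_left smult_free_mult_right fa.scale_right_diff_distrib)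
    with scale I show ?case
      by (simp add: ideal_smult)
  next
    case (gen y f)
    have "bracket (gen x) (gen y * f) = bracket (gen x) (gen y) * f + gen y * bracket (gen x) f"
      by (simp add: bracket_def algebra_simps)
    with gen assms show ?case
      by (simp add: ideal_add ideal_left ideal_right)
  qed (use I in \<open>simp add: bracket_def ideal_zero\<close>)
  then show ?thesis
  proof (induction f rule: free_alg_induct)
    case (add f h)
    have "bracket (f + h) g = bracket f g + bracket h g"
      by (simp add: bracket_def algebra_simps)
    with add I show ?case
      by (simp add: ideal_add)
  next
    case (scale c f)
    have "bracket (smult_free c f) g = smult_free c (bracket f g)"
      by (simp add: bracket_def smult_free_mult_left smult_free_mult_right fa.scale_right_diff_distrib)
    with scale I show ?case
      by (simp add: ideal_smult)
  next
    case (gen y f)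
    have "bracket (gen y * f) g = gen y * bracket f g + bracket (gen y) g * f"
      by (simp add: bracket_def algebra_simps)
    with gen I show ?case
      by (simp add: ideal_add ideal_left ideal_right)
  qed (use I in \<open>simp add: bracket_def ideal_zero\<close>)
qed

section \<open>The commutator ideal and its square\<close>

definition comm_ideal :: "'a::field free_alg set" where
  "comm_ideal = fa.span {f * bracket g h * k | f g h k. True}"

definition comm_ideal2 :: "'a::field free_alg set" where
  "comm_ideal2 = fa.span {p * q | p q. p \<in> comm_ideal \<and> q \<in> comm_ideal}"

lemma two_sided_ideal_comm_ideal: "two_sided_ideal comm_ideal"
  unfolding comm_ideal_def
proof (rule two_sided_ideal_span; intro fa.span_base)
  fix s :: "'a free_alg" and x
  assume "s \<in> {f * bracket g h * k | f g h k. True}"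
  then obtain f g h k where "s = f * bracket g h * k"
    by blast
  then have "gen x * s = (gen x * f) * bracket g h * k" "s * gen x = f * bracket g h * (k * gen x)"
    by (simp_all add: mult.assoc)
  then show "gen x * s \<in> {f * bracket g h * k | f g h k. True}"
    "s * gen x \<in> {f * bracket g h * k | f g h k. True}"
    by blast+
qed

lemma bracket_in_comm_ideal: "bracket f g \<in> comm_ideal"
  unfolding comm_ideal_def by (rule fa.span_base) (force intro: exI[of _ 1])

lemma two_sided_ideal_comm_ideal2: "two_sided_ideal comm_ideal2"
  unfolding comm_ideal2_def
proof (rule two_sided_ideal_span; intro fa.span_base)
  fix s :: "'a free_alg" and x
  assume "s \<in> {p * q | p q. p \<in> comm_ideal \<and> q \<in> comm_ideal}"
  then obtain p q where "p \<in> comm_ideal" "q \<in> comm_ideal" "s = p * q"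
    by blast
  then have "gen x * s = (gen x * p) * q" "s * gen x = p * (q * gen x)"
    "gen x * p \<in> comm_ideal" "q * gen x \<in> comm_ideal"
    by (simp_all add: mult.assoc ideal_left ideal_right two_sided_ideal_comm_ideal)
  then show "gen x * s \<in> {p * q | p q. p \<in> comm_ideal \<and> q \<in> comm_ideal}"
    "s * gen x \<in> {p * q | p q. p \<in> comm_ideal \<and> q \<in> comm_ideal}"
    using \<open>p \<in> comm_ideal\<close> \<open>q \<in> comm_ideal\<close> by blast+
qed

lemma mult_in_comm_ideal2: "p \<in> comm_ideal \<Longrightarrow> q \<in> comm_ideal \<Longrightarrow> p * q \<in> comm_ideal2"
  unfolding comm_ideal2_def by (rule fa.span_base) blast

lemma star_bracket: "star (bracket f g) = bracket (star g) (star f)"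
  by (simp add: bracket_def star_diff star_mult)

lemma star_in_comm_ideal:
  assumes "f \<in> comm_ideal"
  shows "star f \<in> comm_ideal"
  by (rule span_linear_image[OF assms[unfolded comm_ideal_def]])
     (auto simp: star_mult star_bracket star_add star_smult ideal_subspace two_sided_ideal_comm_ideal
       bracket_in_comm_ideal ideal_left ideal_right)

lemma star_in_comm_ideal2:
  assumes "f \<in> comm_ideal2"
  shows "star f \<in> comm_ideal2"
  by (rule span_linear_image[OF assms[unfolded comm_ideal2_def]])
     (auto simp: star_mult star_add star_smult ideal_subspace two_sided_ideal_comm_ideal2
       mult_in_comm_ideal2 star_in_comm_ideal)

text \<open>New letters are bracketed on from the left, so \<open>xs\<close> acts through the
  operators \<open>ad x\<close>. These commute modulo the square of the commutator ideal, hence only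
  the multiset of \<open>xs\<close> matters there.\<close>

definition ad_comm :: "var list \<Rightarrow> var \<Rightarrow> var \<Rightarrow> 'a::field free_alg" where
  "ad_comm xs i j = foldr (\<lambda>x. bracket (gen x)) xs (bracket (gen i) (gen j))"

lemma ad_comm_Nil: "ad_comm [] i j = bracket (gen i) (gen j)"
  and ad_comm_Cons: "ad_comm (x # xs) i j = bracket (gen x) (ad_comm xs i j)"
  by (simp_all add: ad_comm_def)

lemma ad_comm_swap: "ad_comm xs j i = - ad_comm xs i j"
  by (induction xs) (simp_all add: ad_comm_Nil ad_comm_Cons bracket_def)

lemma ad_comm_in_comm_ideal: "ad_comm xs i j \<in> comm_ideal"
  by (induction xs)
     (simp_all add: ad_comm_Nil ad_comm_Cons bracket_in_comm_ideal)

lemma bracket_in_commutators: "v \<in> commutators \<Longrightarrow> bracket v f \<in> commutators"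
proof -
  assume "v \<in> commutators"
  then obtain as where "length as \<ge> 2" "v = left_normed as"
    by (auto simp: commutators_def)
  moreover from this have "as \<noteq> []"
    by auto
  ultimately have "bracket v f = left_normed (as @ [f])" "length (as @ [f]) \<ge> 2"
    by (simp_all add: left_normed_snoc)
  then show ?thesis
    unfolding commutators_def by blast
qed

text \<open>Needed because \<open>ad_comm\<close> brackets on the left while
  \<open>commutators\<close> are left-normed: \<open>[x, v] = [-v, x]\<close>. The sign is absorbed
  by the first entry.\<close>

lemma uminus_in_commutators:
  fixes v :: "'a::field free_alg"
  assumes "v \<in> commutators"
  shows "- v \<in> commutators"
proof -
  have "foldl bracket (- a) as = - foldl bracket a as" for a :: "'a free_alg" and as
  proof (induction as arbitrary: a)
    case (Cons b as)
    have "bracket (- a) b = - bracket a b"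
      by (simp add: bracket_def)
    then show ?case
      by (simp add: Cons)
  qed simp
  moreover obtain bs where bs: "v = left_normed bs" "length bs \<ge> 2"
    using assms unfolding commutators_def by blast
  moreover obtain a as where "bs = a # as"
    using bs(2) by (cases bs) auto
  ultimately have "- v = left_normed (- a # as)" "length (- a # as) \<ge> 2"
    by simp_all
  then show ?thesis
    unfolding commutators_def by blast
qed

lemma ad_comm_in_commutators: "(ad_comm xs i j :: 'a::field free_alg) \<in> commutators"
proof (induction xs)
  case Nil
  show ?case
    by (auto simp: commutators_def ad_comm_Nil intro!: exI[of _ "[gen i, gen j]"])
next
  case (Cons x xs)
  have "(ad_comm (x # xs) i j :: 'a free_alg) = bracket (- ad_comm xs i j) (gen x)"
    by (simp add: ad_comm_Cons bracket_def)
  with Cons show ?case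
    by (simp add: bracket_in_commutators uminus_in_commutators)
qed

text \<open>A letter to the right of a commutator moves to its left by
  \<open>v x = x v - [x, v]\<close>, and \<open>[x, v]\<close> is again of the form
  \<open>ad_comm\<close>.\<close>

lemma comm_ideal_span:
  "comm_ideal \<subseteq> fa.span {word u * ad_comm xs i j :: 'a::field free_alg | u xs i j. True}"
    (is "_ \<subseteq> fa.span ?B")
proof -
  have "two_sided_ideal (fa.span ?B)"
  proof (rule two_sided_ideal_span)
    fix s :: "'a free_alg" and x
    assume "s \<in> ?B"
    then obtain u xs i j where s: "s = word u * ad_comm xs i j"
      by blast
    have "gen x * s = word (x # u) * ad_comm xs i j"
      by (simp add: s word_Cons mult.assoc)
    then show "gen x * s \<in> fa.span ?B"
      by (intro fa.span_base) blast
    have "s * gen x = word (u @ [x]) * ad_comm xs i j - word u * ad_comm (x # xs) i j"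
      by (simp add: s word_append word_Cons ad_comm_Cons bracket_def algebra_simps)
    also have "\<dots> \<in> fa.span ?B"
      by (intro fa.span_diff fa.span_base) blast+
    finally show "s * gen x \<in> fa.span ?B" .
  qed
  note I = this
  have "bracket f g \<in> fa.span ?B" for f g
  proof (rule bracket_mem_ideal[OF I])
    show "bracket (gen x) (gen y) \<in> fa.span ?B" for x y
      by (intro fa.span_base) (force simp: ad_comm_Nil intro: exI[of _ "[]"])
  qed
  then have "f * bracket g h * k \<in> fa.span ?B" for f g h k
    by (intro ideal_right[OF I] ideal_left[OF I])
  then have "{f * bracket g h * k | f g h k. True} \<subseteq> fa.span ?B"
    by blast
  then show ?thesis
    unfolding comm_ideal_def by (intro fa.span_minimal fa.subspace_span)
qed

text \<open>Insertion sort: exchanging the two leading letters suffices, because \<open>Cons\<close>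
  transports congruences under a common prefix. One argument serves words and iterated
  commutators.\<close>

lemma foldr_perm_cong:
  assumes J: "two_sided_ideal J"
    and swap: "\<And>x y xs. g (x # y # xs) - g (y # x # xs) \<in> J"
    and Cons: "\<And>x xs ys. g xs - g ys \<in> J \<Longrightarrow> g (x # xs) - g (x # ys) \<in> J"
    and "mset xs = mset ys"
  shows "g xs - g ys \<in> J"
proof -
  have trans: "g xs - g zs \<in> J" if "g xs - g ys \<in> J" "g ys - g zs \<in> J" for xs ys zs
    using ideal_add[OF J that] by simp
  have front: "g (as @ x # bs) - g (x # as @ bs) \<in> J" for as x bs
  proof (induction as)
    case (Cons a as)
    then show ?case
      using trans[OF assms(3)[OF Cons] swap] by simp
  qed (simp add: ideal_zero[OF J])
  show ?thesis
    using assms(4)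
  proof (induction xs arbitrary: ys)
    case Nil
    then show ?case
      by (simp add: ideal_zero[OF J])
  next
    case (Cons x xs)
    then have "x \<in> set ys"
      by (metis list.set_intros(1) mset_eq_setD)
    then obtain as bs where ys: "ys = as @ x # bs"
      by (auto simp: in_set_conv_decomp)
    with Cons.prems have "mset xs = mset (as @ bs)"
      by simp
    then have "g (x # xs) - g (x # as @ bs) \<in> J"
      by (intro assms(3) Cons.IH)
    moreover have "g (x # as @ bs) - g ys \<in> J"
      using ideal_uminus[OF J front[of as x bs]] by (simp add: ys)
    ultimately show ?case
      by (rule trans)
  qed
qed

lemma word_perm:
  assumes "mset xs = mset ys"
  shows "(word xs - word ys :: 'a::field free_alg) \<in> comm_ideal"
  using two_sided_ideal_comm_ideal _ _ assms
proof (rule foldr_perm_cong)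
  fix x y :: var and xs ys :: "var list"
  have "(word (x # y # xs) - word (y # x # xs) :: 'a free_alg) = bracket (gen x) (gen y) * word xs"
    by (simp add: word_Cons bracket_def algebra_simps)
  then show "(word (x # y # xs) - word (y # x # xs) :: 'a free_alg) \<in> comm_ideal"
    by (simp add: ideal_right two_sided_ideal_comm_ideal bracket_in_comm_ideal)
  show "(word (x # xs) - word (x # ys) :: 'a free_alg) \<in> comm_ideal"
    if "(word xs - word ys :: 'a free_alg) \<in> comm_ideal"
    using ideal_left[OF two_sided_ideal_comm_ideal that, of "gen x"]
    by (simp add: word_Cons right_diff_distrib)
qed

text \<open>By Jacobi the exchange of two operators costs \<open>[[x, y], v]\<close>, whose two
  terms are products of elements of the commutator ideal.\<close>

lemma ad_comm_perm:
  assumes "mset xs = mset ys"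
  shows "(ad_comm xs i j - ad_comm ys i j :: 'a::field free_alg) \<in> comm_ideal2"
  using two_sided_ideal_comm_ideal2 _ _ assms
proof (rule foldr_perm_cong[where g = "\<lambda>xs. ad_comm xs i j"])
  fix x y :: var and xs ys :: "var list"
  let ?v = "ad_comm xs i j :: 'a free_alg"
  have "ad_comm (x # y # xs) i j - ad_comm (y # x # xs) i j
      = bracket (gen x) (gen y) * ?v - ?v * bracket (gen x) (gen y)"
    by (simp add: ad_comm_Cons bracket_def algebra_simps)
  then show "(ad_comm (x # y # xs) i j - ad_comm (y # x # xs) i j :: 'a free_alg) \<in> comm_ideal2"
    by (simp add: ideal_diff two_sided_ideal_comm_ideal2 mult_in_comm_ideal2
        bracket_in_comm_ideal ad_comm_in_comm_ideal)
  show "(ad_comm (x # xs) i j - ad_comm (x # ys) i j :: 'a free_alg) \<in> comm_ideal2"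
    if "(ad_comm xs i j - ad_comm ys i j :: 'a free_alg) \<in> comm_ideal2"
    using ideal_bracket[OF two_sided_ideal_comm_ideal2 that, of "gen x"]
    by (simp add: ad_comm_Cons bracket_def algebra_simps)
qed

text \<open>With the extra letter innermost this is the exact Jacobi identity; permuting letters
  modulo the square of the commutator ideal brings that letter to the front.\<close>

lemma ad_comm_jacobi:
  "(ad_comm (m # xs) i j :: 'a::field free_alg) + ad_comm (i # xs) j m + ad_comm (j # xs) m i \<in> comm_ideal2"
proof -
  have zero: "(ad_comm (xs @ [m]) i j :: 'a free_alg) + ad_comm (xs @ [i]) j m + ad_comm (xs @ [j]) m i = 0"
    (is "?a xs + ?b xs + ?c xs = 0")
  proof (induction xs)
    case Nil
    show ?case
      by (simp add: ad_comm_Nil ad_comm_Cons bracket_def algebra_simps)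
  next
    case (Cons x xs)
    have "?a (x # xs) + ?b (x # xs) + ?c (x # xs) = bracket (gen x) (?a xs + ?b xs + ?c xs)"
      by (simp add: ad_comm_Cons bracket_def algebra_simps)
    then show ?case
      by (simp only: Cons) (simp add: bracket_def)
  qed
  have "(ad_comm (x # xs) k l :: 'a free_alg) - ad_comm (xs @ [x]) k l \<in> comm_ideal2" for x k l
    by (rule ad_comm_perm) simp
  from ideal_add[OF two_sided_ideal_comm_ideal2 ideal_add[OF two_sided_ideal_comm_ideal2
      this[of m i j] this[of i j m]] this[of j m i]]
  have "(ad_comm (m # xs) i j :: 'a free_alg) + ad_comm (i # xs) j m + ad_comm (j # xs) m i
      - (ad_comm (xs @ [m]) i j + ad_comm (xs @ [i]) j m + ad_comm (xs @ [j]) m i) \<in> comm_ideal2"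
    by (simp add: algebra_simps)
  then show ?thesis
    by (simp add: zero)
qed

section \<open>Consequences of the generators\<close>

definition gen_ideal :: "'a::field free_alg set" where
  "gen_ideal = T_star_ideal hull (gens1 \<union> gens2 \<union> gens3)"

lemma T_star_ideal_gen_ideal: "T_star_ideal (gen_ideal :: 'a::field free_alg set)"
  unfolding gen_ideal_def by (rule hull_in) (auto simp: T_star_ideal_def two_sided_ideal_def)

lemma gens_subset_gen_ideal: "gens1 \<union> gens2 \<union> gens3 \<subseteq> gen_ideal"
  unfolding gen_ideal_def by (rule hull_subset)

lemma gen_ideal_subset: "gen_ideal \<subseteq> (star_identities :: 'a::field free_alg set)"
  unfolding gen_ideal_def using gens_sound T_star_ideal_star_identities by (rule hull_minimal)

lemma gen_ideal_two_sided: "two_sided_ideal gen_ideal"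
  and gen_ideal_endo: "star_endo \<phi> \<Longrightarrow> f \<in> gen_ideal \<Longrightarrow> \<phi> f \<in> gen_ideal"
  using T_star_ideal_gen_ideal by (auto simp: T_star_ideal_def)

lemmas gen_ideal_add = ideal_add[OF gen_ideal_two_sided]
  and gen_ideal_diff = ideal_diff[OF gen_ideal_two_sided]
  and gen_ideal_left = ideal_left[OF gen_ideal_two_sided]
  and gen_ideal_right = ideal_right[OF gen_ideal_two_sided]
  and gen_ideal_subspace = ideal_subspace[OF gen_ideal_two_sided]
  and comm_ideal2_left = ideal_left[OF two_sided_ideal_comm_ideal2]
  and comm_ideal2_right = ideal_right[OF two_sided_ideal_comm_ideal2]

text \<open>In the first family the commutators are adjacent. A factor in between moves left by
  \<open>v a = a v + [v, a]\<close>, and \<open>[v, a]\<close> is again a commutator.\<close>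

lemma commutators_mult_3:
  fixes a b :: "'a::field free_alg"
  assumes "v1 \<in> commutators" and "v2 \<in> commutators" and "v3 \<in> commutators"
  shows "v1 * a * v2 * b * v3 \<in> gen_ideal"
proof -
  have *: "v1 * v2 * v3 \<in> gen_ideal"
    if "v1 \<in> commutators" "v2 \<in> commutators" "v3 \<in> commutators" for v1 v2 v3 :: "'a free_alg"
    using gens_subset_gen_ideal that by (auto simp: gens1_def)
  have **: "v1 * a * v2 * v3 \<in> gen_ideal"
    if "v1 \<in> commutators" "v2 \<in> commutators" "v3 \<in> commutators" for a v1 v2 v3 :: "'a free_alg"
  proof -
    have "v1 * a * v2 * v3 = a * (v1 * v2 * v3) + bracket v1 a * v2 * v3"
      by (simp add: bracket_def algebra_simps)
    with that show ?thesis
      by (simp add: gen_ideal_add gen_ideal_left * bracket_in_commutators)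
  qed
  have "v1 * a * v2 * b * v3 = v1 * (a * b) * v2 * v3 + v1 * a * bracket v2 b * v3"
    by (simp add: bracket_def algebra_simps)
  with assms show ?thesis
    by (simp add: gen_ideal_add ** bracket_in_commutators)
qed

lemma comm_ideal_mult_3:
  fixes p q r :: "'a::field free_alg"
  assumes p: "p \<in> comm_ideal" and q: "q \<in> comm_ideal" and r: "r \<in> comm_ideal"
  shows "p * q * r \<in> gen_ideal"
proof (rule span_linear_image[OF subsetD[OF comm_ideal_span p], of "\<lambda>p. p * q * r"])
  fix p :: "'a free_alg"
  assume "p \<in> {word u * ad_comm xs i j | u xs i j. True}"
  then obtain u xs i j where p: "p = word u * ad_comm xs i j"
    by blast
  show "p * q * r \<in> gen_ideal"
  proof (rule span_linear_image[OF subsetD[OF comm_ideal_span q], of "\<lambda>q. p * q * r"])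
    fix q :: "'a free_alg"
    assume "q \<in> {word u * ad_comm xs i j | u xs i j. True}"
    then obtain u' xs' i' j' where q: "q = word u' * ad_comm xs' i' j'"
      by blast
    show "p * q * r \<in> gen_ideal"
    proof (rule span_linear_image[OF subsetD[OF comm_ideal_span r], of "\<lambda>r. p * q * r"])
      fix r :: "'a free_alg"
      assume "r \<in> {word u * ad_comm xs i j | u xs i j. True}"
      then obtain u'' xs'' i'' j'' where r: "r = word u'' * ad_comm xs'' i'' j''"
        by blast
      have "p * q * r = word u * (ad_comm xs i j * word u' * ad_comm xs' i' j' * word u''
          * ad_comm xs'' i'' j'')"
        by (simp add: p q r mult.assoc)
      then show "p * q * r \<in> gen_ideal"
        by (simp only: gen_ideal_left commutators_mult_3 ad_comm_in_commutators)
    qed (simp_all add: gen_ideal_subspace distrib_left smult_free_mult_right)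
  qed (simp_all add: gen_ideal_subspace algebra_simps smult_free_mult_left smult_free_mult_right)
qed (simp_all add: gen_ideal_subspace algebra_simps smult_free_mult_left)

lemma comm_ideal_mult_comm_ideal2:
  fixes p f :: "'a::field free_alg"
  assumes "p \<in> comm_ideal" and "f \<in> comm_ideal2"
  shows "p * f \<in> gen_ideal" and "f * p \<in> gen_ideal"
proof -
  show "p * f \<in> gen_ideal"
    by (rule span_linear_image[OF assms(2)[unfolded comm_ideal2_def], of "\<lambda>f. p * f"])
       (use assms(1) in \<open>auto simp: gen_ideal_subspace distrib_left smult_free_mult_right
          simp flip: mult.assoc intro: comm_ideal_mult_3\<close>)
  show "f * p \<in> gen_ideal"
    by (rule span_linear_image[OF assms(2)[unfolded comm_ideal2_def], of "\<lambda>f. f * p"])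
       (use assms(1) in \<open>auto simp: gen_ideal_subspace distrib_right smult_free_mult_left
          intro: comm_ideal_mult_3\<close>)
qed

lemma comm_ideal2_span:
  "comm_ideal2 \<subseteq> fa.span {r * v1 * v2 :: 'a::field free_alg | r v1 v2.
      v1 \<in> commutators \<and> v2 \<in> commutators}" (is "_ \<subseteq> fa.span ?D")
  unfolding comm_ideal2_def
proof (intro fa.span_minimal fa.subspace_span subsetI)
  fix f :: "'a free_alg"
  assume "f \<in> {p * q | p q. p \<in> comm_ideal \<and> q \<in> comm_ideal}"
  then obtain p q where f: "f = p * q" and p: "p \<in> comm_ideal" and q: "q \<in> comm_ideal"
    by blast
  have "p * q \<in> fa.span ?D"
  proof (rule span_linear_image[OF subsetD[OF comm_ideal_span p], of "\<lambda>p. p * q"])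
    fix p :: "'a free_alg"
    assume "p \<in> {word u * ad_comm xs i j | u xs i j. True}"
    then obtain u xs i j where p: "p = word u * ad_comm xs i j"
      by blast
    show "p * q \<in> fa.span ?D"
    proof (rule span_linear_image[OF subsetD[OF comm_ideal_span q], of "\<lambda>q. p * q"])
      fix q :: "'a free_alg"
      assume "q \<in> {word u * ad_comm xs i j | u xs i j. True}"
      then obtain u' xs' i' j' where q: "q = word u' * ad_comm xs' i' j'"
        by blast
      have "p * q = (word u * word u') * ad_comm xs i j * ad_comm xs' i' j'
          + word u * bracket (ad_comm xs i j) (word u') * ad_comm xs' i' j'"
        by (simp add: p q bracket_def algebra_simps)
      also have "\<dots> \<in> fa.span ?D"
        using ad_comm_in_commutators bracket_in_commutators
        by (intro fa.span_add fa.span_base) blast+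
      finally show "p * q \<in> fa.span ?D" .
    qed (simp_all add: algebra_simps smult_free_mult_right)
  qed (simp_all add: algebra_simps smult_free_mult_left)
  with f show "f \<in> fa.span ?D"
    by simp
qed

lemma fsubst_comp: "fsubst.feval \<theta> (fsubst.feval \<eta> f) = fsubst.feval (\<lambda>x. fsubst.feval \<theta> (\<eta> x)) f"
proof -
  have "fsubst.feval \<theta> (fsubst.feval \<eta> f)
      = fsubst.feval (\<lambda>x. fsubst.feval \<theta> (fsubst.feval \<eta> (gen x))) f"
    by (rule fsubst.feval_unique)
       (simp_all add: fsubst.feval_add fsubst.feval_mult fsubst.feval_smult smult_free_conv_single
         fsubst.feval_single)
  then show ?thesis
    by simp
qed

lemma fsubst_gen: "fsubst.feval gen f = f"
  using fsubst.feval_unique[of "\<lambda>f. f" f] by (simp add: smult_free_conv_single)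

lemma star_endo_commutators:
  assumes "star_endo \<phi>" and "v \<in> commutators"
  shows "\<phi> v \<in> commutators"
proof -
  have foldl: "\<phi> (foldl bracket a bs) = foldl bracket (\<phi> a) (map \<phi> bs)" for a bs
  proof (induction bs arbitrary: a)
    case (Cons b bs)
    have "\<phi> (bracket a b) = bracket (\<phi> a) (\<phi> b)"
      by (simp add: bracket_def star_endo_diff[OF assms(1)] star_endo_mult[OF assms(1)])
    then show ?case
      by (simp add: Cons)
  qed simp
  obtain as where as: "v = left_normed as" "length as \<ge> 2"
    using assms(2) unfolding commutators_def by blast
  then have "\<phi> v = left_normed (map \<phi> as)" "length (map \<phi> as) \<ge> 2"
    by (cases as; simp add: foldl)+
  then show ?thesis
    unfolding commutators_def by blast
qed

text \<open>The translation \<open>y \<mapsto> y + 1\<close> of all symmetric variables is an automorphism that preserves the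
  set of commutators, so it removes the middle variable from the second family of generators.\<close>

lemma commutators_mult_star:
  fixes v1 v2 :: "'a::field free_alg"
  assumes "v1 \<in> commutators" and "v2 \<in> commutators"
  shows "v1 * v2 - star v2 * star v1 \<in> gen_ideal"
proof -
  define shift :: "'a free_alg \<Rightarrow> var \<Rightarrow> 'a free_alg"
    where "shift c x = (case x of Y i \<Rightarrow> gen x + c | Z i \<Rightarrow> gen x)" for c x
  define \<phi> where "\<phi> = fsubst.feval (shift 1)"
  define \<psi> where "\<psi> = fsubst.feval (shift (- 1))"
  have \<phi>: "star_endo \<phi>" and \<psi>: "star_endo \<psi>"
    unfolding \<phi>_def \<psi>_def by (rule feval_star_endo; simp add: shift_def star_add star_diff)+
  have "(\<lambda>x. fsubst.feval (shift 1) (shift (- 1) x)) = gen"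
    by (rule ext) (auto simp: shift_def fsubst.feval_add fsubst.feval_diff split: var.split)
  then have inv: "\<phi> (\<psi> f) = f" for f
    by (simp add: \<phi>_def \<psi>_def fsubst_comp fsubst_gen)
  have gens: "v1 * gen (Y 0) * v2 - star v2 * gen (Y 0) * star v1 \<in> gen_ideal"
    if "v1 \<in> commutators" "v2 \<in> commutators" for v1 v2 :: "'a free_alg"
  proof -
    have "v1 * gen (Y 0) * v2 - star v2 * star (gen (Y 0)) * star v1 \<in> gens2"
      using that unfolding gens2_def by blast
    from subsetD[OF gens_subset_gen_ideal UnI1[OF UnI2[OF this]]] show ?thesis
      by simp
  qed
  \<comment> \<open>Commutators shifted back by \<psi> in advance return to themselves under \<phi>,
    so only the middle variable changes, to \<open>y + 1\<close>; subtracting the relation with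
    \<open>y\<close> leaves the claim.\<close>
  have "\<phi> (\<psi> v1 * gen (Y 0) * \<psi> v2 - star (\<psi> v2) * gen (Y 0) * star (\<psi> v1)) \<in> gen_ideal"
    using star_endo_commutators[OF \<psi>] assms by (intro gen_ideal_endo[OF \<phi>] gens) auto
  then have "v1 * (gen (Y 0) + 1) * v2 - star v2 * (gen (Y 0) + 1) * star v1 \<in> gen_ideal"
    by (simp add: star_endo_diff[OF \<phi>] star_endo_mult[OF \<phi>] star_endo_star[OF \<phi>] inv)
       (simp add: \<phi>_def shift_def)
  from gen_ideal_diff[OF this gens[OF assms]] show ?thesis
    by (simp add: algebra_simps)
qed

text \<open>Modulo the ideal, for \<open>f = r v1 v2\<close> the second family turns
  \<open>v1 v2 x\<close> into \<open>star x star v2 star v1\<close>, which is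
  \<open>star x v1 v2\<close> by \<open>commutators_mult_star\<close>; moving \<open>star x\<close>
  past \<open>r\<close> costs a product of three commutators. So on the square of the commutator
  ideal right multiplication is left multiplication twisted by \<open>star\<close>.\<close>

lemma comm_ideal2_mult_gen:
  fixes f :: "'a::field free_alg"
  assumes "f \<in> comm_ideal2"
  shows "f * gen x - star (gen x) * f \<in> gen_ideal"
proof (rule span_linear_image[OF subsetD[OF comm_ideal2_span assms],
      of "\<lambda>f. f * gen x - star (gen x) * f"])
  fix f :: "'a free_alg"
  assume "f \<in> {r * v1 * v2 | r v1 v2. v1 \<in> commutators \<and> v2 \<in> commutators}"
  then obtain r v1 v2 where v: "v1 \<in> commutators" "v2 \<in> commutators" and f: "f = r * v1 * v2"
    by blast
  let ?u = "gen x"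
  have mem: "v \<in> comm_ideal" if v: "v \<in> commutators" for v :: "'a free_alg"
    using v by (elim commutators_cases) (simp add: bracket_in_comm_ideal)
  have "v1 * v2 * ?u - star ?u * star v2 * star v1 \<in> gens2"
    using v unfolding gens2_def by blast
  then have 1: "r * (v1 * v2 * ?u - star ?u * star v2 * star v1) \<in> gen_ideal"
    using gens_subset_gen_ideal by (intro gen_ideal_left) blast
  have 2: "r * star ?u * (v1 * v2 - star v2 * star v1) \<in> gen_ideal"
    by (intro gen_ideal_left commutators_mult_star v)
  have 3: "bracket r (star ?u) * v1 * v2 \<in> gen_ideal"
    by (intro comm_ideal_mult_3 bracket_in_comm_ideal mem v)
  have "f * ?u - star ?u * f = r * (v1 * v2 * ?u - star ?u * star v2 * star v1)
      - r * star ?u * (v1 * v2 - star v2 * star v1) + bracket r (star ?u) * v1 * v2"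
    by (simp add: f bracket_def algebra_simps)
  then show "f * ?u - star ?u * f \<in> gen_ideal"
    by (simp only: gen_ideal_add gen_ideal_diff 1 2 3)
qed (simp_all add: gen_ideal_subspace algebra_simps smult_free_mult_left smult_free_mult_right
    fa.scale_right_diff_distrib)

lemma comm_ideal2_mult_right:
  fixes f :: "'a::field free_alg"
  assumes "f \<in> comm_ideal2"
  shows "f * g - star g * f \<in> gen_ideal"
  using assms
proof (induction g arbitrary: f rule: free_alg_induct)
  case (add g h)
  have "f * (g + h) - star (g + h) * f = (f * g - star g * f) + (f * h - star h * f)"
    by (simp add: star_add algebra_simps)
  with add show ?case
    by (simp only: gen_ideal_add)
next
  case (scale c g)
  have "f * smult_free c g - star (smult_free c g) * f = smult_free c (f * g - star g * f)"
    by (simp add: star_smult smult_free_mult_left smult_free_mult_right fa.scale_right_diff_distrib)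
  with scale show ?case
    by (simp only: ideal_smult[OF gen_ideal_two_sided])
next
  case one
  show ?case
    by (simp add: ideal_zero[OF gen_ideal_two_sided])
next
  case (gen x g)
  have "f * (gen x * g) - star (gen x * g) * f
      = ((f * gen x) * g - star g * (f * gen x)) + star g * (f * gen x - star (gen x) * f)"
    by (simp add: star_mult algebra_simps)
  with gen show ?case
    by (simp only: gen_ideal_add gen_ideal_left comm_ideal2_right comm_ideal2_mult_gen)
qed

text \<open>Modulo the ideal, \<open>star (r v1 v2) = star v2 star v1 star r\<close> becomes
  \<open>v1 v2 star r\<close>, and twisting \<open>star r\<close> back to the left gives
  \<open>r v1 v2\<close>.\<close>

lemma comm_ideal2_star:
  fixes f :: "'a::field free_alg"
  assumes "f \<in> comm_ideal2"
  shows "f - star f \<in> gen_ideal"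
proof (rule span_linear_image[OF subsetD[OF comm_ideal2_span assms], of "\<lambda>f. f - star f"])
  fix f :: "'a free_alg"
  assume "f \<in> {r * v1 * v2 | r v1 v2. v1 \<in> commutators \<and> v2 \<in> commutators}"
  then obtain r v1 v2 where v: "v1 \<in> commutators" "v2 \<in> commutators" and f: "f = r * v1 * v2"
    by blast
  have "v1 * v2 \<in> comm_ideal2"
    using v by (elim commutators_cases) (simp add: bracket_in_comm_ideal mult_in_comm_ideal2)
  then have 1: "v1 * v2 * star r - star (star r) * (v1 * v2) \<in> gen_ideal"
    by (rule comm_ideal2_mult_right)
  have 2: "(v1 * v2 - star v2 * star v1) * star r \<in> gen_ideal"
    by (intro gen_ideal_right commutators_mult_star v)
  have "f - star f = (v1 * v2 - star v2 * star v1) * star r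
      - (v1 * v2 * star r - star (star r) * (v1 * v2))"
    by (simp add: f star_mult algebra_simps)
  with 1 2 show "f - star f \<in> gen_ideal"
    by (simp only: gen_ideal_diff)
qed (simp_all add: gen_ideal_subspace star_add star_smult fa.scale_right_diff_distrib)

lemma pluecker_in_gen_ideal:
  "bracket (gen (Y i)) (gen (Y j)) * bracket (gen (Y k)) (gen (Y l))
    + bracket (gen (Y j)) (gen (Y k)) * bracket (gen (Y i)) (gen (Y l))
    + bracket (gen (Y k)) (gen (Y i)) * bracket (gen (Y j)) (gen (Y l))
    \<in> (gen_ideal :: 'a::field free_alg set)"
proof -
  define \<theta> :: "var \<Rightarrow> 'a free_alg" where
    "\<theta> x = (if x = Y 1 then gen (Y i) else if x = Y 2 then gen (Y j) else if x = Y 3 then gen (Y k)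
      else if x = Y 4 then gen (Y l) else gen x)" for x
  have endo: "star_endo (fsubst.feval \<theta>)"
    by (rule feval_star_endo) (simp_all add: \<theta>_def)
  let ?f = "left_normed [gen (Y 1), gen (Y 2)] * left_normed [gen (Y 3), gen (Y 4)]
    + left_normed [gen (Y 2), gen (Y 3)] * left_normed [gen (Y 1), gen (Y 4)]
    + left_normed [gen (Y 3), gen (Y 1)] * left_normed [gen (Y 2), gen (Y 4)] :: 'a free_alg"
  have "?f \<in> gens3"
    by (simp add: gens3_def)
  then have "fsubst.feval \<theta> ?f \<in> gen_ideal"
    by (intro gen_ideal_endo[OF endo] subsetD[OF gens_subset_gen_ideal] UnI2)
  moreover have "fsubst.feval \<theta> (bracket f g) = bracket (fsubst.feval \<theta> f) (fsubst.feval \<theta> g)" for f g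
    by (simp add: bracket_def fsubst.feval_diff fsubst.feval_mult)
  ultimately show ?thesis
    by (simp add: \<theta>_def fsubst.feval_add fsubst.feval_mult)
qed

text \<open>A skew variable \<open>z\<close> in front is eliminated by
  \<open>[z, v] w\<^sup>* + v [z, w]\<^sup>* = z (v w\<^sup>*) - (v w\<^sup>*) z\<close>, which equals \<open>2 z (v w\<^sup>*)\<close> modulo the ideal.\<close>

lemma comm_ideal2_span_normal:
  "comm_ideal2 \<subseteq> fa.span ({word (map Y u) * ad_comm xs i j * star (ad_comm ys k l)
      :: 'a::field_char_0 free_alg | u xs i j ys k l. True} \<union> gen_ideal)" (is "_ \<subseteq> fa.span (?B \<union> _)")
proof -
  let ?S = "fa.span (?B \<union> gen_ideal)"
  have I: "f \<in> ?S" if "f \<in> gen_ideal" for f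
    using that by (simp add: fa.span_base)
  have cong: "f \<in> ?S" if "f - g \<in> gen_ideal" "g \<in> ?S" for f g
    using fa.span_add[OF I[OF that(1)] that(2)] by simp
  \<comment> \<open>Induction from the right end of \<open>w\<close> keeps its last letter next to
    the symmetric block. A symmetric letter joins \<open>u\<close>; a skew one passes through
    \<open>u\<close>, at the cost of an element of the cube of the commutator ideal, and then
    lengthens \<open>xs\<close> or \<open>ys\<close>.\<close>
  have word: "word w * word (map Y u) * (ad_comm xs i j * star (ad_comm ys k l)) \<in> ?S"
    for w u xs i j ys k l
  proof (induction w arbitrary: u xs ys rule: rev_induct)
    case Nil
    have "word (map Y u) * ad_comm xs i j * star (ad_comm ys k l) \<in> ?B"
      by blast
    then show ?case
      by (simp add: fa.span_base mult.assoc)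
  next
    case (snoc x w)
    show ?case
    proof (cases x)
      case (Y n)
      then show ?thesis
        using snoc[of "n # u" xs ys] by (simp add: word_append word_Cons mult.assoc)
    next
      case (Z n)
      let ?v = "ad_comm xs i j :: 'a free_alg" and ?v' = "star (ad_comm ys k l) :: 'a free_alg"
      let ?u = "word (map Y u) :: 'a free_alg" and ?z = "gen x :: 'a free_alg" and ?w = "word w :: 'a free_alg"
      have f: "?v * ?v' \<in> comm_ideal2"
        by (intro mult_in_comm_ideal2 ad_comm_in_comm_ideal star_in_comm_ideal)
      have "smult_free (1/2) (?w * ?u * (ad_comm (x # xs) i j * ?v')
          + ?w * ?u * (?v * star (ad_comm (x # ys) k l))) \<in> ?S"
        by (intro fa.span_scale fa.span_add snoc)
      moreover have "word (w @ [x]) * ?u * (?v * ?v') - smult_free (1/2) (?w * ?u * (ad_comm (x # xs) i j * ?v')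
          + ?w * ?u * (?v * star (ad_comm (x # ys) k l))) \<in> gen_ideal"
      proof -
        have "?w * (bracket ?z ?u * (?v * ?v')) \<in> gen_ideal"
          by (intro gen_ideal_left comm_ideal_mult_comm_ideal2 bracket_in_comm_ideal f)
        moreover have "smult_free (1/2) (?w * ?u * (?v * ?v' * ?z - star ?z * (?v * ?v'))) \<in> gen_ideal"
          by (intro gen_ideal_left ideal_smult[OF gen_ideal_two_sided] comm_ideal2_mult_right f)
        moreover have "word (w @ [x]) * ?u * (?v * ?v') - smult_free (1/2) (?w * ?u * (ad_comm (x # xs) i j * ?v')
          + ?w * ?u * (?v * star (ad_comm (x # ys) k l)))
          = ?w * (bracket ?z ?u * (?v * ?v'))
          + smult_free (1/2) (?w * ?u * (?v * ?v' * ?z - star ?z * (?v * ?v')))"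
        proof -
          have half: "h = smult_free (1/2) (h + h)" for h :: "'a free_alg"
            by (rule poly_mapping_eqI) (simp add: lookup_add)
          have "word (w @ [x]) * ?u * (?v * ?v') - ?w * (bracket ?z ?u * (?v * ?v'))
            = ?w * ?u * ?z * (?v * ?v')"
            by (simp add: word_append word_Cons bracket_def algebra_simps)
          also have "\<dots> = smult_free (1/2) (?w * ?u * ?z * (?v * ?v') + ?w * ?u * ?z * (?v * ?v'))"
            by (rule half)
          also have "\<dots> = smult_free (1/2) (?w * ?u * (ad_comm (x # xs) i j * ?v')
              + ?w * ?u * (?v * star (ad_comm (x # ys) k l)))
            + smult_free (1/2) (?w * ?u * (?v * ?v' * ?z - star ?z * (?v * ?v')))"
            unfolding fa.scale_right_distrib[symmetric]
            by (rule arg_cong[where f = "smult_free (1/2)"])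
               (simp add: Z ad_comm_Cons bracket_def star_diff star_mult algebra_simps)
          finally show ?thesis
            by (simp add: algebra_simps)
        qed
        ultimately show ?thesis
          by (simp only: gen_ideal_add)
      qed
      ultimately show ?thesis
        by (rule cong[rotated])
    qed
  qed
  have "p * q \<in> ?S" if p: "p \<in> comm_ideal" and q: "q \<in> comm_ideal" for p q :: "'a free_alg"
  proof -
    \<comment> \<open>Expanding \<open>star q\<close> instead of \<open>q\<close> makes the second
      factor end in \<open>star (word u')\<close>, and this trailing word is twisted to the
      front.\<close>
    have "p * star (star q) \<in> ?S"
    proof (rule span_linear_image[OF subsetD[OF comm_ideal_span p], of "\<lambda>p. p * star (star q)"])
      fix p :: "'a free_alg"
      assume "p \<in> {word u * ad_comm xs i j | u xs i j. True}"
      then obtain u xs i j where p: "p = word u * ad_comm xs i j"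
        by blast
      show "p * star (star q) \<in> ?S"
      proof (rule span_linear_image[OF subsetD[OF comm_ideal_span star_in_comm_ideal[OF q]],
            of "\<lambda>q. p * star q"])
        fix q :: "'a free_alg"
        assume "q \<in> {word u * ad_comm xs i j | u xs i j. True}"
        then obtain u' ys k l where q: "q = word u' * ad_comm ys k l"
          by blast
        let ?f = "word u * (ad_comm xs i j * star (ad_comm ys k l)) :: 'a free_alg"
        have "?f * star (word u') - star (star (word u')) * ?f \<in> gen_ideal"
          by (intro comm_ideal2_mult_right comm_ideal2_left mult_in_comm_ideal2 ad_comm_in_comm_ideal
              star_in_comm_ideal)
        moreover have "p * star q = ?f * star (word u')"
          by (simp add: p q star_mult mult.assoc)
        moreover have "star (star (word u')) * ?f \<in> ?S"
          using word[of "u' @ u" "[]" xs i j ys k l] by (simp add: word_append mult.assoc)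
        ultimately show "p * star q \<in> ?S"
          by (simp only: cong)
      qed (simp_all add: star_add star_smult algebra_simps smult_free_mult_right)
    qed (simp_all add: algebra_simps smult_free_mult_left)
    then show ?thesis
      by simp
  qed
  then show ?thesis
    unfolding comm_ideal2_def by (intro fa.span_minimal fa.subspace_span) blast
qed

section \<open>A Koszul-type contraction\<close>

lemma sum_mset_subtract: "(\<Sum>x\<in>#M. f x) - (\<Sum>x\<in>#M. g x) = (\<Sum>x\<in>#M. f x - g x :: 'a::ab_group_add)"
  by (induction M) (simp_all add: algebra_simps)

lemma sum_mset_cong_in: "(\<And>x. x \<in># M \<Longrightarrow> f x = g x) \<Longrightarrow> (\<Sum>x\<in>#M. f x) = (\<Sum>x\<in>#M. g x)"
  by (rule arg_cong[where f = sum_mset]) (rule image_mset_cong)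

lemma add_mset_remove1: "m \<in># W \<Longrightarrow> add_mset x W - {#m#} = add_mset x (W - {#m#})"
  using diff_union_single_conv[of m W "{#x#}"] by simp

text \<open>The left side composes the boundary \<open>t_i c_j - t_j c_i\<close> with contraction
  along the variables in \<open>P\<close>, a partial Euler field. Each letter of \<open>W\<close> in
  \<open>P\<close> contributes one copy of \<open>G W i j\<close> by Jacobi, and the added letters
  \<open>i\<close> and \<open>j\<close> contribute theirs directly, so the factor is the degree in
  the variables of \<open>P\<close>.\<close>

lemma euler_identity:
  fixes G :: "'v multiset \<Rightarrow> 'v \<Rightarrow> 'v \<Rightarrow> 'a::field"
  assumes anti: "\<And>V i j. G V j i = - G V i j"
    and jacobi: "\<And>V m i j. G (add_mset m V) i j + G (add_mset i V) j m + G (add_mset j V) m i = 0"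
  shows "(\<Sum>m\<in>#filter_mset P (add_mset i W). G (add_mset i W - {#m#}) m j)
      - (\<Sum>m\<in>#filter_mset P (add_mset j W). G (add_mset j W - {#m#}) m i)
    = of_nat (size (filter_mset P W) + of_bool (P i) + of_bool (P j)) * G W i j"
proof -
  have split: "(\<Sum>m\<in>#filter_mset P (add_mset x W). G (add_mset x W - {#m#}) m y)
      = of_bool (P x) * G W x y + (\<Sum>m\<in>#filter_mset P W. G (add_mset x (W - {#m#})) m y)" for x y
  proof -
    have "(\<Sum>m\<in>#filter_mset P W. G (add_mset x W - {#m#}) m y)
        = (\<Sum>m\<in>#filter_mset P W. G (add_mset x (W - {#m#})) m y)"
      by (rule sum_mset_cong_in) (simp add: add_mset_remove1)
    then show ?thesis
      by simp
  qed
  have "(\<Sum>m\<in>#filter_mset P W. G (add_mset i (W - {#m#})) m j)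
      - (\<Sum>m\<in>#filter_mset P W. G (add_mset j (W - {#m#})) m i)
      = (\<Sum>m\<in>#filter_mset P W. G W i j)"
    unfolding sum_mset_subtract
  proof (rule sum_mset_cong_in)
    fix m
    assume "m \<in># filter_mset P W"
    then have "G W i j + G (add_mset i (W - {#m#})) j m + G (add_mset j (W - {#m#})) m i = 0"
      using jacobi[of m "W - {#m#}" i j] by simp
    then show "G (add_mset i (W - {#m#})) m j - G (add_mset j (W - {#m#})) m i = G W i j"
      using anti[of "add_mset i (W - {#m#})" m j] by Groebner_Basis.algebra
  qed
  then show ?thesis
    unfolding split using anti[of W i j] by (simp add: algebra_simps)
qed

text \<open>The case of symmetric variables only. Their letters pass between the two commutators, so
  one multiset \<open>V\<close> records the letters of both.\<close>

locale pure_form =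
  fixes G :: "'v multiset \<Rightarrow> 'v \<Rightarrow> 'v \<Rightarrow> 'v \<Rightarrow> 'v \<Rightarrow> 'a::field_char_0"
  assumes anti: "G V j i k l = - G V i j k l"
    and jacobi: "G (add_mset m V) i j k l + G (add_mset i V) j m k l + G (add_mset j V) m i k l = 0"
    and sym: "G V i j k l = G V k l i j"
    and pluecker_empty: "G {#} i j k l + G {#} j k i l + G {#} k i j l = 0"
begin

lemma anti2: "G V i j l k = - G V i j k l"
  using anti[of V l k i j] sym[of V i j] by simp

lemma jacobi2: "G (add_mset m V) i j k l + G (add_mset k V) i j l m + G (add_mset l V) i j m k = 0"
  using jacobi[of m V k l i j] sym[of _ i j] by simp

lemma alternating1: "G (add_mset i V) m j k l - G (add_mset j V) m i k l = G (add_mset m V) i j k l"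
  using jacobi[of m V i j k l] anti[of "add_mset i V" m j k l] by Groebner_Basis.algebra

lemma alternating2: "G (add_mset k V) i j m l - G (add_mset l V) i j m k = G (add_mset m V) i j k l"
  using alternating1[of k V m l i j] by (simp add: sym[of _ i j])

text \<open>Multiplying by a further variable makes the Pluecker expression antisymmetric in its four indices
  and symmetric in the last index and the new one, so it vanishes.\<close>

lemma pluecker: "G V i j k l + G V j k i l + G V k i j l = 0"
proof (cases V)
  case empty
  then show ?thesis
    by (simp add: pluecker_empty)
next
  case (add m D)
  define P where "P m i j k l = G (add_mset m D) i j k l + G (add_mset m D) j k i l
    + G (add_mset m D) k i j l" for m i j k l
  have 1: "P m i j k l = P l i j k m" for i j k l m
  proof -
    have "P m i j k l - P l i j k m
      = (G (add_mset m D) i j k l + G (add_mset k D) i j l m + G (add_mset l D) i j m k)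
      + (G (add_mset m D) j k i l + G (add_mset i D) j k l m + G (add_mset l D) j k m i)
      + (G (add_mset m D) k i j l + G (add_mset j D) k i l m + G (add_mset l D) k i m j)
      - (G (add_mset k D) i j l m + G (add_mset i D) j k l m + G (add_mset j D) k i l m)"
      unfolding P_def
      by (simp add: anti2[of "add_mset l D" i j m k] anti2[of "add_mset l D" j k m i]
          anti2[of "add_mset l D" k i m j])
    also have "\<dots> = 0"
      by (simp add: jacobi jacobi2)
    finally show ?thesis
      by simp
  qed
  have 2: "P m i j l k = - P m i j k l" for i j k l m
    unfolding P_def
    using anti2[of "add_mset m D" i j l k] sym[of "add_mset m D" j l i k]
      sym[of "add_mset m D" l i j k] anti[of "add_mset m D" i k j l] anti2[of "add_mset m D" j k l i]
    by Groebner_Basis.algebra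
  \<comment> \<open>Two distinct transpositions \<open>a\<close>, \<open>b\<close> of three letters
    satisfy \<open>(a b)^3 = 1\<close>. Here one preserves \<open>P\<close> and the other changes
    its sign, so going round gives the sign -1.\<close>
  have "P m i j k l = - P m i j k l"
    using 1[of m i j k l] 2[of l i j k m] 1[of l i j m k] 2[of k i j m l] 1[of k i j l m] 2[of m i j k l]
    by simp
  then have "P m i j k l = 0"
    by simp
  then show ?thesis
    by (simp add: P_def add)
qed

text \<open>The monomial \<open>t^W c_a d_b\<close> does not show which letters belong to which
  factor, so an ordered pair of distinct occurrences is drawn from \<open>W\<close> in all possible
  ways, one for each commutator.\<close>

definition double_sum :: "'v multiset \<Rightarrow> 'v \<Rightarrow> 'v \<Rightarrow> 'a" where
  "double_sum W a b = (\<Sum>m\<in>#W. \<Sum>m'\<in>#W - {#m#}. G (W - {#m#} - {#m'#}) m a m' b)"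

text \<open>The three groups are the pairs that use both of the new letters \<open>x\<close> and
  \<open>y\<close>, exactly one of them, and none.\<close>

lemma double_sum_add2:
  "double_sum (add_mset x (add_mset y W)) a b
    = (G W x a y b + G W y a x b)
    + (\<Sum>m\<in>#W. G (add_mset y (W - {#m#})) x a m b + G (add_mset x (W - {#m#})) y a m b
        + G (add_mset y (W - {#m#})) m a x b + G (add_mset x (W - {#m#})) m a y b)
    + (\<Sum>m\<in>#W. \<Sum>m'\<in>#W - {#m#}. G (add_mset x (add_mset y (W - {#m#} - {#m'#}))) m a m' b)"
proof -
  have 1: "(\<Sum>m'\<in>#add_mset y W. G (add_mset y W - {#m'#}) x a m' b)
      = G W x a y b + (\<Sum>m\<in>#W. G (add_mset y (W - {#m#})) x a m b)" for x y
  proof -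
    have "(\<Sum>m'\<in>#W. G (add_mset y W - {#m'#}) x a m' b) = (\<Sum>m\<in>#W. G (add_mset y (W - {#m#})) x a m b)"
      by (rule sum_mset_cong_in) (simp add: add_mset_remove1)
    then show ?thesis
      by simp
  qed
  have 2: "(\<Sum>m\<in>#W. \<Sum>m'\<in>#add_mset x (add_mset y W) - {#m#}.
        G (add_mset x (add_mset y W) - {#m#} - {#m'#}) m a m' b)
      = (\<Sum>m\<in>#W. G (add_mset y (W - {#m#})) m a x b + G (add_mset x (W - {#m#})) m a y b
        + (\<Sum>m'\<in>#W - {#m#}. G (add_mset x (add_mset y (W - {#m#} - {#m'#}))) m a m' b))"
  proof (rule sum_mset_cong_in)
    fix m
    assume m: "m \<in># W"
    then have eq: "add_mset x (add_mset y W) - {#m#} = add_mset x (add_mset y (W - {#m#}))"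
      by (simp add: add_mset_remove1)
    have "(\<Sum>m'\<in>#W - {#m#}. G (add_mset x (add_mset y (W - {#m#})) - {#m'#}) m a m' b)
        = (\<Sum>m'\<in>#W - {#m#}. G (add_mset x (add_mset y (W - {#m#} - {#m'#}))) m a m' b)"
      by (rule sum_mset_cong_in) (simp add: add_mset_remove1)
    then show "(\<Sum>m'\<in>#add_mset x (add_mset y W) - {#m#}.
          G (add_mset x (add_mset y W) - {#m#} - {#m'#}) m a m' b)
        = G (add_mset y (W - {#m#})) m a x b + G (add_mset x (W - {#m#})) m a y b
          + (\<Sum>m'\<in>#W - {#m#}. G (add_mset x (add_mset y (W - {#m#} - {#m'#}))) m a m' b)"
      unfolding eq by (simp add: add_mset_commute[of x y] algebra_simps)
  qed
  have "double_sum (add_mset x (add_mset y W)) a b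
      = (\<Sum>m'\<in>#add_mset y W. G (add_mset y W - {#m'#}) x a m' b)
      + (\<Sum>m'\<in>#add_mset x W. G (add_mset x W - {#m'#}) y a m' b)
      + (\<Sum>m\<in>#W. \<Sum>m'\<in>#add_mset x (add_mset y W) - {#m#}.
        G (add_mset x (add_mset y W) - {#m#} - {#m'#}) m a m' b)"
    by (simp add: double_sum_def add_mset_commute[of x y])
  also have "\<dots> = (G W x a y b + G W y a x b)
    + (\<Sum>m\<in>#W. G (add_mset y (W - {#m#})) x a m b + G (add_mset x (W - {#m#})) y a m b
        + G (add_mset y (W - {#m#})) m a x b + G (add_mset x (W - {#m#})) m a y b)
    + (\<Sum>m\<in>#W. \<Sum>m'\<in>#W - {#m#}. G (add_mset x (add_mset y (W - {#m#} - {#m'#}))) m a m' b)"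
    unfolding 1 2 by (simp only: sum_mset.distrib add_ac)
  finally show ?thesis .
qed

text \<open>With \<open>n = size W\<close> the three groups contribute \<open>6\<close>,
  \<open>6 n\<close> and \<open>n (n - 1)\<close> copies of \<open>G W i j k l\<close>, in total
  \<open>(n + 2) (n + 3)\<close>. The last two come from the exchange relations
  \<open>alternating1\<close> and \<open>alternating2\<close>, the first from the Pluecker
  relation.\<close>

lemma double_sum_alternating:
  "double_sum (add_mset i (add_mset k W)) j l - double_sum (add_mset i (add_mset l W)) j k
    - double_sum (add_mset j (add_mset k W)) i l + double_sum (add_mset j (add_mset l W)) i k
    = of_nat ((size W + 2) * (size W + 3)) * G W i j k l"
proof -
  define h where "h x y a b m = G (add_mset y (W - {#m#})) x a m b + G (add_mset x (W - {#m#})) y a m b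
        + G (add_mset y (W - {#m#})) m a x b + G (add_mset x (W - {#m#})) m a y b" for x y a b m
  define q where "q x y a b m = (\<Sum>m'\<in>#W - {#m#}.
    G (add_mset x (add_mset y (W - {#m#} - {#m'#}))) m a m' b)" for x y a b m
  have expand: "double_sum (add_mset x (add_mset y W)) a b = (G W x a y b + G W y a x b)
      + (\<Sum>m\<in>#W. h x y a b m) + (\<Sum>m\<in>#W. q x y a b m)" for x y a b
    by (simp add: double_sum_add2 h_def q_def)
  \<comment> \<open>Four of the eight terms are \<open>G W i j k l\<close> itself. The other four
    add up to \<open>-2 (G W j k i l + G W k i j l)\<close>, which the Pluecker relation turns into
    two more copies.\<close>
  have c: "(G W i j k l + G W k j i l) - (G W i j l k + G W l j i k) - (G W j i k l + G W k i j l)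
      + (G W j i l k + G W l i j k) = 6 * G W i j k l"
  proof -
    have "G W k j i l = - G W j k i l" "G W i j l k = - G W i j k l" "G W j i k l = - G W i j k l"
      by (rule anti anti2)+
    moreover have "G W j i l k = G W i j k l"
      by (simp add: anti[of W j i] anti2[of W i j l k])
    moreover have "G W l j i k = G W k i j l"
      by (simp add: anti[of W l j] sym[of W j l] anti[of W i k])
    moreover have "G W l i j k = - G W j k i l"
      by (simp add: sym[of W l i] anti2[of W j k l i])
    moreover have "G W i j k l = - G W j k i l - G W k i j l"
      using pluecker[of W i j k l] by Groebner_Basis.algebra
    ultimately show ?thesis
      by simp
  qed
  have h: "h i k j l m - h i l j k m - h j k i l m + h j l i k m = 6 * G W i j k l" if "m \<in># W" for m
  proof -
    define D where "D = W - {#m#}"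
    have W: "W = add_mset m D"
      using that by (simp add: D_def)
    have "h i k j l m - h i l j k m - h j k i l m + h j l i k m
      = 2 * (G (add_mset k D) i j m l - G (add_mset l D) i j m k)
      + (G (add_mset i D) k j m l - G (add_mset j D) k i m l)
      - (G (add_mset i D) l j m k - G (add_mset j D) l i m k)
      + (G (add_mset k D) m j i l - G (add_mset l D) m j i k)
      - (G (add_mset k D) m i j l - G (add_mset l D) m i j k)
      + 2 * (G (add_mset i D) m j k l - G (add_mset j D) m i k l)"
      unfolding h_def D_def[symmetric]
      by (simp add: anti[of "add_mset k D" j i] anti[of "add_mset l D" j i]
          anti2[of "add_mset i D" m j l k] anti2[of "add_mset j D" m i l k])
    also have "\<dots> = 4 * G W i j k l + (G (add_mset k D) i j m l - G (add_mset l D) i j m k)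
      + (G (add_mset i D) m j k l - G (add_mset j D) m i k l)"
      by (simp add: alternating1 alternating2 W)
    also have "\<dots> = 6 * G W i j k l"
      by (simp add: alternating1 alternating2 W)
    finally show ?thesis .
  qed
  have q: "q i k j l m - q i l j k m - q j k i l m + q j l i k m = of_nat (size W - 1) * G W i j k l"
    if m: "m \<in># W" for m
  proof -
    have "q i k j l m - q i l j k m - q j k i l m + q j l i k m
        = (q i k j l m - q i l j k m) - (q j k i l m - q j l i k m)"
      by (simp add: algebra_simps)
    also have "\<dots> = (\<Sum>m'\<in>#W - {#m#}. G W i j k l)"
      unfolding q_def sum_mset_subtract
    proof (rule sum_mset_cong_in)
      fix m'
      assume m': "m' \<in># W - {#m#}"
      define D where "D = W - {#m#} - {#m'#}"
      have W: "W = add_mset m (add_mset m' D)"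
        unfolding D_def insert_DiffM[OF m'] insert_DiffM[OF m] ..
      have 1: "G (add_mset i (add_mset x D)) m j m' y - G (add_mset j (add_mset x D)) m i m' y
          = G (add_mset x (add_mset m D)) i j m' y" for x y
        by (simp add: alternating1 add_mset_commute[of m x])
      have 2: "G (add_mset k (add_mset m D)) i j m' l - G (add_mset l (add_mset m D)) i j m' k
          = G W i j k l"
        unfolding W
        by (simp add: alternating2 add_mset_commute[of m m'])
      show "G (add_mset i (add_mset k (W - {#m#} - {#m'#}))) m j m' l
          - G (add_mset i (add_mset l (W - {#m#} - {#m'#}))) m j m' k
          - (G (add_mset j (add_mset k (W - {#m#} - {#m'#}))) m i m' l
            - G (add_mset j (add_mset l (W - {#m#} - {#m'#}))) m i m' k) = G W i j k l"
        unfolding D_def[symmetric] 2[symmetric] 1[symmetric] by (simp add: algebra_simps)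
    qed
    also have "\<dots> = of_nat (size W - 1) * G W i j k l"
      using m by (simp add: size_Diff_singleton)
    finally show ?thesis .
  qed
  have "(\<Sum>m\<in>#W. h i k j l m) - (\<Sum>m\<in>#W. h i l j k m) - (\<Sum>m\<in>#W. h j k i l m) + (\<Sum>m\<in>#W. h j l i k m)
      = (\<Sum>m\<in>#W. h i k j l m - h i l j k m - h j k i l m + h j l i k m)"
    by (simp only: sum_mset_subtract sum_mset.distrib[symmetric])
  also have "\<dots> = (\<Sum>m\<in>#W. 6 * G W i j k l)"
    by (rule sum_mset_cong_in) (rule h)
  finally have H: "(\<Sum>m\<in>#W. h i k j l m) - (\<Sum>m\<in>#W. h i l j k m) - (\<Sum>m\<in>#W. h j k i l m)
      + (\<Sum>m\<in>#W. h j l i k m) = 6 * of_nat (size W) * G W i j k l"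
    by simp
  have "(\<Sum>m\<in>#W. q i k j l m) - (\<Sum>m\<in>#W. q i l j k m) - (\<Sum>m\<in>#W. q j k i l m) + (\<Sum>m\<in>#W. q j l i k m)
      = (\<Sum>m\<in>#W. q i k j l m - q i l j k m - q j k i l m + q j l i k m)"
    by (simp only: sum_mset_subtract sum_mset.distrib[symmetric])
  also have "\<dots> = (\<Sum>m\<in>#W. of_nat (size W - 1) * G W i j k l)"
    by (rule sum_mset_cong_in) (rule q)
  finally have Q: "(\<Sum>m\<in>#W. q i k j l m) - (\<Sum>m\<in>#W. q i l j k m) - (\<Sum>m\<in>#W. q j k i l m)
      + (\<Sum>m\<in>#W. q j l i k m) = of_nat (size W * (size W - 1)) * G W i j k l"
    by simp
  \<comment> \<open>The case split is for the truncated \<open>size W - 1\<close> at an empty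
    \<open>W\<close>.\<close>
  have n: "of_nat ((size W + 2) * (size W + 3))
      = (of_nat (size W * (size W - 1)) + 6 * of_nat (size W) + 6 :: 'a)"
    by (cases "size W") (simp_all add: algebra_simps)
  have "double_sum (add_mset i (add_mset k W)) j l - double_sum (add_mset i (add_mset l W)) j k
    - double_sum (add_mset j (add_mset k W)) i l + double_sum (add_mset j (add_mset l W)) i k
    = ((G W i j k l + G W k j i l) - (G W i j l k + G W l j i k) - (G W j i k l + G W k i j l)
      + (G W j i l k + G W l i j k))
    + ((\<Sum>m\<in>#W. h i k j l m) - (\<Sum>m\<in>#W. h i l j k m) - (\<Sum>m\<in>#W. h j k i l m)
      + (\<Sum>m\<in>#W. h j l i k m))
    + ((\<Sum>m\<in>#W. q i k j l m) - (\<Sum>m\<in>#W. q i l j k m) - (\<Sum>m\<in>#W. q j k i l m)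
      + (\<Sum>m\<in>#W. q j l i k m))"
    unfolding expand by (simp add: algebra_simps)
  also have "\<dots> = of_nat ((size W + 2) * (size W + 3)) * G W i j k l"
    unfolding c H Q n by (simp add: algebra_simps)
  finally show ?thesis .
qed

end

section \<open>Contraction in the presence of skew variables\<close>

definition is_Z :: "var \<Rightarrow> bool" where
  "is_Z x \<longleftrightarrow> (case x of Y _ \<Rightarrow> False | Z _ \<Rightarrow> True)"

lemma is_Z_simps [simp]: "is_Z (Z n)" "\<not> is_Z (Y n)"
  by (simp_all add: is_Z_def)

lemma not_is_Z_iff: "\<not> is_Z x \<longleftrightarrow> (\<exists>n. x = Y n)"
  by (cases x) simp_all

text \<open>The relations among the values of a functional on \<open>u v star w\<close>, for fixed
  \<open>u\<close>, as functions of the letters of \<open>v\<close> and \<open>w\<close>.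
  \<open>swap\<close> expresses that the square of the commutator ideal is symmetric under
  \<open>star\<close>, and \<open>move\<close> that a symmetric letter acts equally on both
  factors.\<close>

locale normal_form =
  fixes N :: "var multiset \<Rightarrow> var \<Rightarrow> var \<Rightarrow> var multiset \<Rightarrow> var \<Rightarrow> var \<Rightarrow> 'a::field_char_0"
  assumes anti: "N W j i S k l = - N W i j S k l"
    and jacobi: "N (add_mset m W) i j S k l + N (add_mset i W) j m S k l + N (add_mset j W) m i S k l = 0"
    and swap: "N W i j S k l = N S k l W i j"
    and move: "N (add_mset (Y n) W) i j S k l = N W i j (add_mset (Y n) S) k l"
    and pluecker: "N {#} (Y a) (Y b) {#} (Y c) (Y d) + N {#} (Y b) (Y c) {#} (Y a) (Y d)
      + N {#} (Y c) (Y a) {#} (Y b) (Y d) = 0"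
begin

lemma anti2: "N W i j S l k = - N W i j S k l"
  using anti[of S l k W i j] swap[of W i j] by simp

lemma jacobi2: "N W i j (add_mset m S) k l + N W i j (add_mset k S) l m + N W i j (add_mset l S) m k = 0"
  using jacobi[of m S k l W i j] swap[of W i j] by simp

lemma move_filter: "N (W + filter_mset (\<lambda>x. \<not> is_Z x) T) i j S k l
    = N W i j (S + filter_mset (\<lambda>x. \<not> is_Z x) T) k l"
proof (induction T arbitrary: S)
  case (add x T)
  then show ?case
    by (cases x) (simp_all add: move)
qed simp

text \<open>\<open>contract W S i k\<close> is the image of the monomial \<open>t\<^bsup>W\<^esup> s\<^bsup>S\<^esup> c\<^sub>i d\<^sub>k\<close>, where \<open>S\<close> consists of
  skew variables. The first factor is contracted along its skew variables if there are any and along its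
  symmetric ones otherwise; the denominators are the corresponding degrees.\<close>

definition contract0 :: "var multiset \<Rightarrow> var multiset \<Rightarrow> var \<Rightarrow> var \<Rightarrow> 'a" where
  "contract0 W S i k =
    (let A = size (filter_mset is_Z W) + of_bool (is_Z i); B = size S + of_bool (is_Z k);
         P = (\<lambda>x. A = 0 \<or> is_Z x)
     in if B \<noteq> 0
       then (\<Sum>m\<in>#filter_mset P W. \<Sum>m'\<in>#S. N (W - {#m#}) m i (S - {#m'#}) m' k)
         / of_nat ((size (filter_mset P W) + of_bool (P i)) * B)
       else (\<Sum>m\<in>#W. \<Sum>m'\<in>#W - {#m#}. N (W - {#m#} - {#m'#}) m i {#} m' k)
         / of_nat (size W * (size W + 1)))"

text \<open>If only the first factor carries skew letters, the factors trade places, which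
  \<open>swap\<close> justifies. The second branch of \<open>contract0\<close> is thus reached only
  by monomials without skew letters.\<close>

definition contract :: "var multiset \<Rightarrow> var multiset \<Rightarrow> var \<Rightarrow> var \<Rightarrow> 'a" where
  "contract W S i k =
    (if size S + of_bool (is_Z k) = 0 \<and> size (filter_mset is_Z W) + of_bool (is_Z i) \<noteq> 0
     then contract0 (filter_mset (\<lambda>x. \<not> is_Z x) W + S) (filter_mset is_Z W) k i
     else contract0 W S i k)"

text \<open>The value at \<open>t^W s^S c_i d_k\<close> for arbitrary \<open>S\<close>: symmetric
  letters of \<open>S\<close> may join \<open>W\<close> because their \<open>s\<close> equals their
  \<open>t\<close>.\<close>

definition contract_ts :: "var multiset \<Rightarrow> var multiset \<Rightarrow> var \<Rightarrow> var \<Rightarrow> 'a" where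
  "contract_ts W S = contract (W + filter_mset (\<lambda>x. \<not> is_Z x) S) (filter_mset is_Z S)"

lemma filter_mset_Z_Y [simp]:
  "filter_mset is_Z (filter_mset (\<lambda>x. \<not> is_Z x) M) = {#}"
  "filter_mset (\<lambda>x. \<not> is_Z x) (filter_mset is_Z M) = {#}"
  by (induction M) auto

lemma filter_Z_partition: "filter_mset is_Z M + filter_mset (\<lambda>x. \<not> is_Z x) M = M"
  by (rule multiset_partition[symmetric])

text \<open>Euler's homotopy on the first factor, with the second contraction kept as an outer sum.
  Meanwhile the symmetric letters of \<open>S\<close> sit in the pool of the first factor;
  \<open>move_filter\<close> returns them.\<close>

lemma contract_ts_difference:
  assumes B: "size (filter_mset is_Z (add_mset k S)) + of_bool (is_Z l) \<noteq> 0"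
  shows "contract_ts (add_mset i W) (add_mset k S) j l - contract_ts (add_mset j W) (add_mset k S) i l
    = (\<Sum>m\<in>#filter_mset is_Z (add_mset k S). N W i j (add_mset k S - {#m#}) m l)
      / of_nat (size (filter_mset is_Z (add_mset k S)) + of_bool (is_Z l))"
proof -
  define T where "T = add_mset k S"
  define TY where "TY = filter_mset (\<lambda>x. \<not> is_Z x) T"
  define TZ where "TZ = filter_mset is_Z T"
  define A where "A = size (filter_mset is_Z W) + of_bool (is_Z i) + of_bool (is_Z j)"
  define B where "B = size TZ + of_bool (is_Z l)"
  define P where "P = (\<lambda>x. A = 0 \<or> is_Z x)"
  define D where "D = size (filter_mset P (W + TY)) + of_bool (P i) + of_bool (P j)"
  have B0: "B \<noteq> 0"
    using assms by (simp add: B_def TZ_def T_def)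
  \<comment> \<open>If \<open>A = 0\<close> every letter satisfies \<open>P\<close>, so
    \<open>i\<close> and \<open>j\<close> count; otherwise \<open>D = A\<close>.\<close>
  have D0: "D \<noteq> 0"
  proof (cases "A = 0")
    case False
    then have "P = is_Z"
      by (simp add: P_def)
    then show ?thesis
      using False by (auto simp: D_def A_def TY_def)
  qed (simp add: D_def P_def)
  \<comment> \<open>\<open>A\<close>, \<open>B\<close>, \<open>P\<close> and \<open>D\<close> are
    unchanged when \<open>i\<close> and \<open>j\<close> are exchanged, so both terms have the
    denominator \<open>D B\<close>.\<close>
  have eval: "contract_ts (add_mset x W) T y l
      = (\<Sum>m'\<in>#TZ. \<Sum>m\<in>#filter_mset P (add_mset x (W + TY)).
          N (add_mset x (W + TY) - {#m#}) m y (TZ - {#m'#}) m' l) / of_nat (D * B)"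
    if "(x = i \<and> y = j) \<or> (x = j \<and> y = i)" for x y
  proof -
    have P_y: "(A = 0 \<or> is_Z y) = P y"
      by (simp add: P_def)
    have *: "size (filter_mset is_Z (add_mset x W + TY)) + of_bool (is_Z y) = A"
      "size (filter_mset P (add_mset x W + TY)) + of_bool (P y) = D"
      using that by (auto simp: A_def D_def TY_def)
    have "(size TZ + of_bool (is_Z l) = 0) = False"
      using B0 by (simp only: B_def)
    then have "contract_ts (add_mset x W) T y l = contract0 (add_mset x W + TY) TZ y l"
      unfolding contract_ts_def contract_def TZ_def[symmetric] TY_def[symmetric]
      by (simp only: simp_thms if_False)
    also have "\<dots> = (\<Sum>m\<in>#filter_mset P (add_mset x W + TY). \<Sum>m'\<in>#TZ.
          N (add_mset x W + TY - {#m#}) m y (TZ - {#m'#}) m' l) / of_nat (D * B)"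
      unfolding contract0_def Let_def *(1) B_def[symmetric] P_def[symmetric]
      unfolding P_y *(2) by (simp only: B0 simp_thms if_True)
    finally show ?thesis
      by (subst sum_mset.swap) simp
  qed
  have "contract_ts (add_mset i W) T j l - contract_ts (add_mset j W) T i l
      = (\<Sum>m'\<in>#TZ. (\<Sum>m\<in>#filter_mset P (add_mset i (W + TY)).
          N (add_mset i (W + TY) - {#m#}) m j (TZ - {#m'#}) m' l)
        - (\<Sum>m\<in>#filter_mset P (add_mset j (W + TY)).
          N (add_mset j (W + TY) - {#m#}) m i (TZ - {#m'#}) m' l)) / of_nat (D * B)"
    by (simp only: eval simp_thms diff_divide_distrib[symmetric] sum_mset_subtract)
  also have "\<dots> = (\<Sum>m'\<in>#TZ. of_nat D * N W i j (T - {#m'#}) m' l) / of_nat (D * B)"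
  proof (rule arg_cong2[where f = "(/)"], rule sum_mset_cong_in)
    fix m'
    assume "m' \<in># TZ"
    then have "TZ - {#m'#} + TY = T - {#m'#}"
      using filter_Z_partition[of T]
      by (metis TY_def TZ_def add.commute diff_union_single_conv insert_DiffM2 subset_mset.diff_add_assoc2
          single_subset_iff)
    then have "N (W + TY) i j (TZ - {#m'#}) m' l = N W i j (T - {#m'#}) m' l"
      by (simp add: TY_def move_filter)
    moreover have "(\<Sum>m\<in>#filter_mset P (add_mset i (W + TY)).
          N (add_mset i (W + TY) - {#m#}) m j (TZ - {#m'#}) m' l)
        - (\<Sum>m\<in>#filter_mset P (add_mset j (W + TY)).
          N (add_mset j (W + TY) - {#m#}) m i (TZ - {#m'#}) m' l)
        = of_nat D * N (W + TY) i j (TZ - {#m'#}) m' l"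
      unfolding D_def
      by (rule euler_identity[where G = "\<lambda>V a b. N V a b (TZ - {#m'#}) m' l"]) (rule anti jacobi)+
    ultimately show "(\<Sum>m\<in>#filter_mset P (add_mset i (W + TY)).
          N (add_mset i (W + TY) - {#m#}) m j (TZ - {#m'#}) m' l)
        - (\<Sum>m\<in>#filter_mset P (add_mset j (W + TY)).
          N (add_mset j (W + TY) - {#m#}) m i (TZ - {#m'#}) m' l)
        = of_nat D * N W i j (T - {#m'#}) m' l"
      by simp
  qed simp
  also have "\<dots> = (\<Sum>m'\<in>#TZ. N W i j (T - {#m'#}) m' l) / of_nat B"
  proof -
    have eq: "(\<Sum>m'\<in>#TZ. of_nat D * N W i j (T - {#m'#}) m' l)
        = of_nat D * (\<Sum>m'\<in>#TZ. N W i j (T - {#m'#}) m' l)"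
      by (rule sum_mset_distrib_left[symmetric])
    show ?thesis
      unfolding eq of_nat_mult by (rule mult_divide_mult_cancel_left) (use D0 in simp)
  qed
  finally show ?thesis
    by (simp only: T_def TZ_def B_def)
qed

text \<open>A second Euler homotopy, now on \<open>k\<close> and \<open>l\<close> along the skew
  letters. Its degree is nonzero by \<open>B\<close>, hence invertible.\<close>

lemma contract_ts_mixed:
  assumes B: "size (filter_mset is_Z S) + of_bool (is_Z k) + of_bool (is_Z l) \<noteq> 0"
  shows "contract_ts (add_mset i W) (add_mset k S) j l - contract_ts (add_mset i W) (add_mset l S) j k
    - contract_ts (add_mset j W) (add_mset k S) i l + contract_ts (add_mset j W) (add_mset l S) i k
    = N W i j S k l"
proof -
  define B where "B = size (filter_mset is_Z S) + of_bool (is_Z k) + of_bool (is_Z l)"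
  have Bk: "size (filter_mset is_Z (add_mset k S)) + of_bool (is_Z l) = B"
    and Bl: "size (filter_mset is_Z (add_mset l S)) + of_bool (is_Z k) = B"
    by (auto simp: B_def)
  have B0: "B \<noteq> 0"
    using assms by (simp add: B_def)
  have "contract_ts (add_mset i W) (add_mset k S) j l - contract_ts (add_mset i W) (add_mset l S) j k
    - contract_ts (add_mset j W) (add_mset k S) i l + contract_ts (add_mset j W) (add_mset l S) i k
    = (contract_ts (add_mset i W) (add_mset k S) j l - contract_ts (add_mset j W) (add_mset k S) i l)
    - (contract_ts (add_mset i W) (add_mset l S) j k - contract_ts (add_mset j W) (add_mset l S) i k)"
    by simp
  also have "\<dots> = ((\<Sum>m\<in>#filter_mset is_Z (add_mset k S). N W i j (add_mset k S - {#m#}) m l)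
    - (\<Sum>m\<in>#filter_mset is_Z (add_mset l S). N W i j (add_mset l S - {#m#}) m k)) / of_nat B"
    using contract_ts_difference[of k S l i W j] contract_ts_difference[of l S k i W j] B0
    unfolding Bk Bl by (simp add: diff_divide_distrib)
  also have "\<dots> = (of_nat B * N W i j S k l) / of_nat B"
    unfolding B_def
    by (subst euler_identity[where G = "\<lambda>V a b. N W i j V a b"]) (rule anti2 jacobi2 refl)+
  also have "\<dots> = N W i j S k l"
    using B0 by simp
  finally show ?thesis .
qed

lemma contract_ts_commute:
  assumes "size (filter_mset is_Z S) + of_bool (is_Z k) = 0"
    and "size (filter_mset is_Z W) + of_bool (is_Z i) \<noteq> 0"
  shows "contract_ts W S i k = contract_ts S W k i"
proof -
  have S: "filter_mset is_Z S = {#}"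
    using assms(1) by simp
  then have SY: "filter_mset (\<lambda>x. \<not> is_Z x) S = S"
    by (metis add_0 filter_Z_partition)
  have "contract_ts W S i k
      = contract0 (filter_mset (\<lambda>x. \<not> is_Z x) (W + S) + {#}) (filter_mset is_Z (W + S)) k i"
    unfolding contract_ts_def contract_def S SY using assms by (simp add: S)
  also have "\<dots> = contract0 (S + filter_mset (\<lambda>x. \<not> is_Z x) W) (filter_mset is_Z W) k i"
    by (simp add: S SY add.commute)
  also have "\<dots> = contract_ts S W k i"
    unfolding contract_ts_def contract_def using assms(2) by (simp only: simp_thms if_False)
  finally show ?thesis .
qed

text \<open>These are the four monomials of
  \<open>t^W (t_i c_j - t_j c_i) s^S (s_k d_l - s_l d_k)\<close>: the contraction recovers the value
  from one summand of the entry (1,4). The three cases are skew letters in the second factor, only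
  in the first, and none.\<close>

lemma contract_ts_alternating:
  "contract_ts (add_mset i W) (add_mset k S) j l - contract_ts (add_mset i W) (add_mset l S) j k
    - contract_ts (add_mset j W) (add_mset k S) i l + contract_ts (add_mset j W) (add_mset l S) i k
    = N W i j S k l"
proof -
  let ?A = "size (filter_mset is_Z W) + of_bool (is_Z i) + of_bool (is_Z j)"
  let ?B = "size (filter_mset is_Z S) + of_bool (is_Z k) + of_bool (is_Z l)"
  consider "?B \<noteq> 0" | "?B = 0" "?A \<noteq> 0" | "?B = 0" "?A = 0"
    by argo
  then show ?thesis
  proof cases
    case 1
    then show ?thesis
      by (rule contract_ts_mixed)
  next
    case 2
    have "contract_ts (add_mset x W) (add_mset y S) x' y' = contract_ts (add_mset y S) (add_mset x W) y' x'"
      if "(x = i \<and> x' = j) \<or> (x = j \<and> x' = i)" "(y = k \<and> y' = l) \<or> (y = l \<and> y' = k)" for x x' y y'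
      using 2 that by (intro contract_ts_commute) auto
    with contract_ts_mixed[OF 2(2), of k S l] show ?thesis
      by (simp add: swap[of W] algebra_simps)
  next
    case 3
    have ex: "\<exists>M'. M = image_mset Y M'" if "filter_mset is_Z M = {#}" for M
      using that
    proof (induction M)
      case (add x M)
      then show ?case
        by (cases x) (auto split: if_splits intro: exI[of _ "add_mset _ _"])
    qed simp
    have "filter_mset is_Z W = {#}" "filter_mset is_Z S = {#}" "\<not> is_Z i" "\<not> is_Z j" "\<not> is_Z k" "\<not> is_Z l"
      using 3 by (auto split: if_splits)
    with ex obtain W' S' i' j' k' l' where eq: "W = image_mset Y W'" "S = image_mset Y S'"
      "i = Y i'" "j = Y j'" "k = Y k'" "l = Y l'"
      unfolding not_is_Z_iff by metis
    have move_Y: "N (V + image_mset Y U) a b T c d = N V a b (T + image_mset Y U) c d" for V U a b T c d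
      by (induction U arbitrary: T) (simp_all add: move)
    \<comment> \<open>As all letters are symmetric, \<open>move\<close> collects those of both
      factors in the first, which gives the situation of \<open>pure_form\<close>.\<close>
    define G where "G V a b c d = N (image_mset Y V) (Y a) (Y b) {#} (Y c) (Y d)" for V a b c d
    interpret pure_form G
    proof
      show "G V b a c d = - G V a b c d" for V a b c d
        unfolding G_def by (rule anti)
      show "G (add_mset m V) a b c d + G (add_mset a V) b m c d + G (add_mset b V) m a c d = 0"
        for m V a b c d
        unfolding G_def using jacobi by simp
      show "G V a b c d = G V c d a b" for V a b c d
        using move_Y[of "{#}" V "Y a" "Y b" "{#}"] by (simp add: G_def swap[of "{#}"])
      show "G {#} a b c d + G {#} b c a d + G {#} c a b d = 0" for a b c d
        using pluecker by (simp add: G_def)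
    qed
    define V where "V = W' + S'"
    have Y_empty: "filter_mset is_Z (image_mset Y M) = {#}" for M
      by (induction M) simp_all
    have Y_all: "filter_mset (\<lambda>x. \<not> is_Z x) (image_mset Y M) = image_mset Y M" for M
      by (induction M) simp_all
    have contract: "contract_ts (add_mset (Y a) W) (add_mset (Y c) S) (Y b) (Y d)
        = double_sum (add_mset a (add_mset c V)) b d / of_nat ((size V + 2) * (size V + 3))" for a b c d
    proof -
      let ?M = "add_mset a (add_mset c V)"
      have "contract_ts (add_mset (Y a) W) (add_mset (Y c) S) (Y b) (Y d)
          = contract0 (image_mset Y ?M) {#} (Y b) (Y d)"
        by (simp add: contract_ts_def contract_def eq Y_empty Y_all V_def add_mset_commute[of "Y a"])
      also have "\<dots> = (\<Sum>m\<in>#image_mset Y ?M. \<Sum>m'\<in>#image_mset Y ?M - {#m#}.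
          N (image_mset Y ?M - {#m#} - {#m'#}) m (Y b) {#} m' (Y d)) / of_nat ((size V + 2) * (size V + 3))"
        unfolding contract0_def Let_def by (simp add: numeral_eq_Suc)
      also have "(\<Sum>m\<in>#image_mset Y ?M. \<Sum>m'\<in>#image_mset Y ?M - {#m#}.
          N (image_mset Y ?M - {#m#} - {#m'#}) m (Y b) {#} m' (Y d)) = double_sum ?M b d"
      proof -
        have Y_diff: "image_mset Y M - {#Y m#} = image_mset Y (M - {#m#})" if "m \<in># M" for m M
          using image_mset_Diff[of "{#m#}" M Y] that by simp
        have "(\<Sum>m\<in>#M. \<Sum>m'\<in>#image_mset Y M - {#Y m#}.
            N (image_mset Y M - {#Y m#} - {#m'#}) (Y m) (Y b) {#} m' (Y d)) = double_sum M b d" for M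
          unfolding double_sum_def
        proof (rule sum_mset_cong_in)
          fix m
          assume "m \<in># M"
          then have "(\<Sum>m'\<in>#image_mset Y M - {#Y m#}.
              N (image_mset Y M - {#Y m#} - {#m'#}) (Y m) (Y b) {#} m' (Y d))
              = (\<Sum>m'\<in>#M - {#m#}. N (image_mset Y (M - {#m#}) - {#Y m'#}) (Y m) (Y b) {#} (Y m') (Y d))"
            by (simp only: Y_diff image_mset.compositionality comp_def)
          also have "\<dots> = (\<Sum>m'\<in>#M - {#m#}. G (M - {#m#} - {#m'#}) m b m' d)"
            by (rule sum_mset_cong_in) (simp only: Y_diff G_def)
          finally show "(\<Sum>m'\<in>#image_mset Y M - {#Y m#}.
              N (image_mset Y M - {#Y m#} - {#m'#}) (Y m) (Y b) {#} m' (Y d))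
              = (\<Sum>m'\<in>#M - {#m#}. G (M - {#m#} - {#m'#}) m b m' d)" .
        qed
        from this[of ?M] show ?thesis
          by (simp only: image_mset.compositionality comp_def)
      qed
      finally show ?thesis .
    qed
    have n: "of_nat ((size V + 2) * (size V + 3)) \<noteq> (0 :: 'a)"
      by (simp only: of_nat_eq_0_iff) simp
    have "contract_ts (add_mset i W) (add_mset k S) j l - contract_ts (add_mset i W) (add_mset l S) j k
        - contract_ts (add_mset j W) (add_mset k S) i l + contract_ts (add_mset j W) (add_mset l S) i k
        = G V i' j' k' l'"
      unfolding eq(3-6) contract diff_divide_distrib[symmetric] add_divide_distrib[symmetric]
        double_sum_alternating
      using n by simp
    also have "\<dots> = N W i j S k l"
      using move_Y[of "image_mset Y W'" S' i j "{#}" k l] by (simp add: G_def V_def eq)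
    finally show ?thesis .
  qed
qed

end

section \<open>Generic evaluation\<close>

text \<open>\<open>PA\<close> is the entry (1,1). \<open>PT\<close> and \<open>PS\<close> stand for
  differences of diagonal entries, not for entries, so that iterated commutators have differences of
  monomials as entries (1,2) and (1,3).\<close>

datatype param = PA var | PT var | PS var | PC var | PD var

abbreviation mono_of :: "'p multiset \<Rightarrow> ('p, 'a::field) mpoly" where
  "mono_of M \<equiv> Poly_Mapping.single M 1"

lemma mono_of_mult: "mono_of M * mono_of N = mono_of (M + N)"
  by (simp add: mult_single)

lemma prod_list_mono_of:
  "prod_list (map (\<lambda>x. mono_of {#g x#}) xs) = mono_of (image_mset g (mset xs))"
  by (induction xs) (simp_all add: mono_of_mult)

text \<open>The entries (2,4), (3,3), (3,4), (4,4) are forced by the reflection. The entry (1,4) is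
  set to zero, since the entries read off later do not involve it.\<close>

definition generic_blk :: "(var \<Rightarrow> 'b::comm_ring_1) \<Rightarrow> (var \<Rightarrow> 'b) \<Rightarrow> (var \<Rightarrow> 'b) \<Rightarrow> (var \<Rightarrow> 'b) \<Rightarrow> var \<Rightarrow> 'b blk" where
  "generic_blk a b c d x = (if is_Z x
     then Blk (a x) (c x) (d x) 0 (b x) (- d x) (- b x) (- c x) (- a x)
     else Blk (a x) (c x) (d x) 0 (b x) (d x) (b x) (c x) (a x))"

lemma star_compatible_generic_blk: "star_compatible (generic_blk a b c d)"
  by (auto simp: star_compatible_def generic_blk_def intro!: blk.expand)

lemma generic_blk_sel [simp]:
  "e11 (generic_blk a b c d x) = a x" "e22 (generic_blk a b c d x) = b x"
  "e12 (generic_blk a b c d x) = c x" "e13 (generic_blk a b c d x) = d x"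
  "e33 (generic_blk a b c d x) = (if is_Z x then - b x else b x)"
  by (simp_all add: generic_blk_def)

context comm_scalars
begin

lemma e11_feval_word: "e11 (blk.feval \<theta> (word u)) = prod_list (map (\<lambda>x. e11 (\<theta> x)) u)"
  by (induction u) (simp_all add: word_Cons blk.feval_mult)

lemma strictly_upper_ad_comm: "strictly_upper (blk.feval \<theta> (ad_comm xs i j))"
  by (cases xs) (simp_all add: ad_comm_Nil ad_comm_Cons strictly_upper_bracket)

text \<open>\<open>ad x\<close> multiplies the entry (1,2) of a strictly upper triangular element by
  \<open>t x\<close>, and the innermost bracket is the boundary
  \<open>t_i c_j - t_j c_i\<close>.\<close>

lemma e12_feval_ad_comm:
  assumes t: "\<And>x. t x = e11 (\<theta> x) - e22 (\<theta> x)"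
  shows "e12 (blk.feval \<theta> (ad_comm xs i j))
    = prod_list (map t xs) * (t i * e12 (\<theta> j) - t j * e12 (\<theta> i))"
proof (induction xs)
  case Nil
  show ?case
    by (simp add: ad_comm_Nil bracket_def blk.feval_diff blk.feval_mult t algebra_simps)
next
  case (Cons x xs)
  have "e12 (blk.feval \<theta> (ad_comm (x # xs) i j)) = t x * e12 (blk.feval \<theta> (ad_comm xs i j))"
    using strictly_upper_ad_comm[of \<theta> xs i j]
    by (simp add: ad_comm_Cons bracket_def blk.feval_diff blk.feval_mult t strictly_upper_def algebra_simps)
  with Cons show ?case
    by (simp add: mult.assoc)
qed

lemma e13_feval_ad_comm:
  assumes s: "\<And>x. s x = e11 (\<theta> x) - e33 (\<theta> x)"
  shows "e13 (blk.feval \<theta> (ad_comm xs i j))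
    = prod_list (map s xs) * (s i * e13 (\<theta> j) - s j * e13 (\<theta> i))"
proof (induction xs)
  case Nil
  show ?case
    by (simp add: ad_comm_Nil bracket_def blk.feval_diff blk.feval_mult s algebra_simps)
next
  case (Cons x xs)
  have "e13 (blk.feval \<theta> (ad_comm (x # xs) i j)) = s x * e13 (blk.feval \<theta> (ad_comm xs i j))"
    using strictly_upper_ad_comm[of \<theta> xs i j]
    by (simp add: ad_comm_Cons bracket_def blk.feval_diff blk.feval_mult s strictly_upper_def algebra_simps)
  with Cons show ?case
    by (simp add: mult.assoc)
qed

text \<open>For strictly upper triangular factors the only paths from 1 to 4 run through 2 and
  through 3, and \<open>bstar\<close> carries the entries (1,3), (1,2) to (2,4), (3,4).\<close>

lemma e14_feval_normal:
  assumes "star_compatible \<theta>"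
  shows "e14 (blk.feval \<theta> (word u * ad_comm xs i j * star (ad_comm ys k l)))
    = prod_list (map (\<lambda>x. e11 (\<theta> x)) u)
      * (e12 (blk.feval \<theta> (ad_comm xs i j)) * e13 (blk.feval \<theta> (ad_comm ys k l))
        + e13 (blk.feval \<theta> (ad_comm xs i j)) * e12 (blk.feval \<theta> (ad_comm ys k l)))"
  using strictly_upper_ad_comm[of \<theta> xs i j] strictly_upper_ad_comm[of \<theta> ys k l]
  by (simp add: blk.feval_mult feval_star[OF assms] strictly_upper_def e11_feval_word algebra_simps)

end

definition list_of :: "'p multiset \<Rightarrow> 'p list" where
  "list_of M = (SOME xs. mset xs = M)"

lemma mset_list_of [simp]: "mset (list_of M) = M"
  unfolding list_of_def using ex_mset[of M] by (rule someI_ex)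


section \<open>Identities lie in the commutator ideal\<close>

text \<open>The common scheme of the three membership proofs: once a nonzero multiple of \<phi>
  factors through the entry \<open>e\<close> on a spanning set, \<phi> vanishes on every identity in
  the span. The factor \<open>c\<close> is 2 for the entry (1,4) and 1 otherwise.\<close>

lemma functional_eq_mon_extend:
  fixes \<phi> :: "'a::field free_alg \<Rightarrow> 'a" and \<theta> :: "var \<Rightarrow> ('p, 'a) mpoly blk"
  assumes \<phi>: "functional \<phi>" and f: "f \<in> fa.span S"
    and S: "\<And>g. g \<in> S \<Longrightarrow> c * \<phi> g = mon_extend \<Lambda> (e (pc.blk.feval \<theta> g))"
    and e: "\<And>a b. e (a + b) = e a + e b" "\<And>k a. e (bscal k * a) = k * e a"
  shows "c * \<phi> f = mon_extend \<Lambda> (e (pc.blk.feval \<theta> f))"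
  using f
proof (induction rule: fa.span_induct_alt)
  case base
  have "e 0 = 0"
    using e(1)[of 0 0] by simp
  then show ?case
    by (simp add: functional_zero[OF \<phi>])
next
  case (step k g h)
  then show ?case
    by (simp add: functional_add[OF \<phi>] functional_scale[OF \<phi>] pc.blk.feval_add pc.blk.feval_smult e
        mon_extend_add mon_extend_scale S[symmetric] algebra_simps)
qed

text \<open>Modulo commutators words are commutative monomials, and the entry (1,1) of the generic
  element reproduces exactly these.\<close>

lemma identity_in_comm_ideal:
  fixes f :: "'a::field_char_0 free_alg"
  assumes f: "f \<in> star_identities"
  shows "f \<in> comm_ideal"
proof (rule ccontr)
  assume "f \<notin> comm_ideal"
  then obtain \<phi> where \<phi>: "functional \<phi>" "\<And>g. g \<in> comm_ideal \<Longrightarrow> \<phi> g = 0" "\<phi> f = 1"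
    using functional_separates[OF ideal_subspace[OF two_sided_ideal_comm_ideal]] by blast
  define \<theta> :: "var \<Rightarrow> (var, 'a) mpoly blk" where
    "\<theta> = generic_blk (\<lambda>x. mono_of {#x#}) (\<lambda>_. 0) (\<lambda>_. 0) (\<lambda>_. 0)"
  have "1 * \<phi> f = mon_extend (\<lambda>M. \<phi> (word (list_of M))) (e11 (pc.blk.feval \<theta> f))"
  proof (rule functional_eq_mon_extend[OF \<phi>(1), of _ "range word"])
    show "f \<in> fa.span (range word)"
      by (simp add: span_words)
    fix g :: "'a free_alg"
    assume "g \<in> range word"
    then obtain u where g: "g = word u"
      by blast
    have "\<phi> (word u - word (list_of (mset u))) = 0"
      by (intro \<phi>(2) word_perm) simp
    then show "1 * \<phi> g = mon_extend (\<lambda>M. \<phi> (word (list_of M))) (e11 (pc.blk.feval \<theta> g))"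
      by (simp add: g pc.e11_feval_word \<theta>_def prod_list_mono_of[where g = "\<lambda>x. x"] functional_diff[OF \<phi>(1)])
  qed simp_all
  moreover have "pc.blk.feval \<theta> f = 0"
    using f unfolding \<theta>_def by (intro generic_feval_eq_0 star_compatible_generic_blk)
  ultimately show False
    using \<phi>(3) by simp
qed

text \<open>Exponents of the monomials in the entry (1,2), and with \<open>encode3\<close> in (1,4).
  Injectivity lets a functional on monomials be defined by decoding through
  \<open>inv_into\<close>.\<close>

definition encode2 :: "var multiset \<times> var multiset \<times> var \<Rightarrow> param multiset" where
  "encode2 = (\<lambda>(U, W, j). image_mset PA U + image_mset PT W + {#PC j#})"

definition encode3 :: "var multiset \<times> var multiset \<times> var multiset \<times> var \<times> var \<Rightarrow> param multiset" where
  "encode3 = (\<lambda>(U, W, S, i, k).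
     image_mset PA U + image_mset PT W + image_mset PS S + {#PC i#} + {#PD k#})"

lemma count_image_mset_constr:
  "count (image_mset PA M) (PA x) = count M x" "count (image_mset PT M) (PT x) = count M x"
  "count (image_mset PS M) (PS x) = count M x"
  by (induction M) simp_all

lemma count_image_mset_distinct:
  "(\<And>x. y \<noteq> g x) \<Longrightarrow> count (image_mset g M) y = 0"
  by (induction M) auto

lemma inj_encode3: "inj encode3"
proof (rule injI)
  fix p q :: "var multiset \<times> var multiset \<times> var multiset \<times> var \<times> var"
  obtain U W S i k U' W' S' i' k' where pq: "p = (U, W, S, i, k)" "q = (U', W', S', i', k')"
    by (cases p, cases q)
  assume "encode3 p = encode3 q"
  then have eq: "encode3 (U, W, S, i, k) = encode3 (U', W', S', i', k')"
    by (simp only: pq)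
  note count_simps = encode3_def count_image_mset_constr count_image_mset_distinct
  have "U = U'"
    using eq[THEN arg_cong, of "\<lambda>M. count M (PA x)" for x]
    by (intro multiset_eqI) (simp add: count_simps)
  moreover have "W = W'"
    using eq[THEN arg_cong, of "\<lambda>M. count M (PT x)" for x]
    by (intro multiset_eqI) (simp add: count_simps)
  moreover have "S = S'"
    using eq[THEN arg_cong, of "\<lambda>M. count M (PS x)" for x]
    by (intro multiset_eqI) (simp add: count_simps)
  moreover have "i = i'"
    using eq[THEN arg_cong, of "\<lambda>M. count M (PC i)"] by (simp add: count_simps split: if_splits)
  moreover have "k = k'"
    using eq[THEN arg_cong, of "\<lambda>M. count M (PD k)"] by (simp add: count_simps split: if_splits)
  ultimately show "p = q"
    by (simp add: pq)
qed

lemma inj_encode2: "inj encode2"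
proof (rule injI)
  fix p q :: "var multiset \<times> var multiset \<times> var"
  obtain U W j U' W' j' where pq: "p = (U, W, j)" "q = (U', W', j')"
    by (cases p, cases q)
  assume "encode2 p = encode2 q"
  then have "encode3 (U, W, {#}, j, j0) = encode3 (U', W', {#}, j', j0)" for j0
    by (simp add: pq encode2_def encode3_def)
  from injD[OF inj_encode3 this] show "p = q"
    by (simp add: pq)
qed

text \<open>The (1,4) argument with one commutator in place of two: \<open>G\<close> holds the
  values on \<open>u v\<close>, and Euler's homotopy along all letters inverts the entry
  (1,2).\<close>

lemma identity_in_comm_ideal2:
  fixes f :: "'a::field_char_0 free_alg"
  assumes f: "f \<in> star_identities"
  shows "f \<in> comm_ideal2"
proof (rule ccontr)
  assume "f \<notin> comm_ideal2"
  then obtain \<phi> where \<phi>: "functional \<phi>" "\<And>g. g \<in> comm_ideal2 \<Longrightarrow> \<phi> g = 0" "\<phi> f = 1"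
    using functional_separates[OF ideal_subspace[OF two_sided_ideal_comm_ideal2]] by blast
  define G where "G U V i j = \<phi> (word (list_of U) * ad_comm (list_of V) i j)" for U V i j
  have G: "\<phi> (word u * ad_comm xs i j) = G (mset u) (mset xs) i j" for u xs i j
  proof -
    let ?u = "word (list_of (mset u)) :: 'a free_alg"
    have "(word u - ?u) * ad_comm xs i j \<in> comm_ideal2"
      by (intro mult_in_comm_ideal2 word_perm ad_comm_in_comm_ideal) simp
    moreover have "?u * (ad_comm xs i j - ad_comm (list_of (mset xs)) i j) \<in> comm_ideal2"
      by (intro comm_ideal2_left ad_comm_perm) simp
    ultimately have "\<phi> ((word u - ?u) * ad_comm xs i j) = 0"
      "\<phi> (?u * (ad_comm xs i j - ad_comm (list_of (mset xs)) i j)) = 0"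
      using \<phi>(2) by blast+
    then show ?thesis
      by (simp add: G_def left_diff_distrib right_diff_distrib functional_diff[OF \<phi>(1)])
  qed
  have anti: "G U V j i = - G U V i j" for U V i j
    unfolding G_def by (simp add: ad_comm_swap[of _ j i] functional_uminus[OF \<phi>(1)])
  have jacobi: "G U (add_mset m V) i j + G U (add_mset i V) j m + G U (add_mset j V) m i = 0" for U V m i j
  proof -
    let ?u = "word (list_of U) :: 'a free_alg" and ?V = "list_of V"
    have "?u * (ad_comm (m # ?V) i j + ad_comm (i # ?V) j m + ad_comm (j # ?V) m i) \<in> comm_ideal2"
      by (intro comm_ideal2_left ad_comm_jacobi)
    then have "\<phi> (?u * (ad_comm (m # ?V) i j + ad_comm (i # ?V) j m + ad_comm (j # ?V) m i)) = 0"
      by (rule \<phi>(2))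
    then show ?thesis
      by (simp add: distrib_left functional_add[OF \<phi>(1)] G)
  qed
  \<comment> \<open>\<open>size W + 1\<close> is the degree of \<open>t^W c_j\<close>, so both
    monomials of a boundary get the same denominator.\<close>
  define L where "L = (\<lambda>(U, W, j). (\<Sum>m\<in>#W. G U (W - {#m#}) m j) / of_nat (size W + 1))"
  have L: "L (U, add_mset i W, j) - L (U, add_mset j W, i) = G U W i j" for U W i j
  proof -
    have nz: "of_nat (size W + 2) \<noteq> (0 :: 'a)"
      by (simp only: of_nat_eq_0_iff)
    have "L (U, add_mset i W, j) - L (U, add_mset j W, i)
        = (of_nat (size W + 2) * G U W i j) / of_nat (size W + 2)"
      using euler_identity[where G = "G U" and P = "\<lambda>_. True" and i = i and W = W and j = j, OF anti jacobi]
      unfolding L_def by (simp add: diff_divide_distrib[symmetric] add.commute)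
    with nz show ?thesis
      by simp
  qed
  define \<theta> :: "var \<Rightarrow> (param, 'a) mpoly blk" where
    "\<theta> = generic_blk (\<lambda>x. mono_of {#PA x#}) (\<lambda>x. mono_of {#PA x#} - mono_of {#PT x#})
      (\<lambda>x. mono_of {#PC x#}) (\<lambda>_. 0)"
  let ?\<Lambda> = "\<lambda>M. L (inv_into UNIV encode2 M)"
  have "1 * \<phi> f = mon_extend ?\<Lambda> (e12 (pc.blk.feval \<theta> f))"
  proof (rule functional_eq_mon_extend[OF \<phi>(1)])
    show "f \<in> fa.span {word u * ad_comm xs i j | u xs i j. True}"
      using identity_in_comm_ideal[OF f] comm_ideal_span by blast
    fix g :: "'a free_alg"
    assume "g \<in> {word u * ad_comm xs i j | u xs i j. True}"
    then obtain u xs i j where g: "g = word u * ad_comm xs i j"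
      by blast
    have t: "mono_of {#PT x#} = e11 (\<theta> x) - e22 (\<theta> x)" for x
      by (simp add: \<theta>_def)
    have "e12 (pc.blk.feval \<theta> g) = mono_of (image_mset PA (mset u))
        * (mono_of (image_mset PT (mset xs)) * (mono_of {#PT i#} * mono_of {#PC j#} - mono_of {#PT j#} * mono_of {#PC i#}))"
      using pc.strictly_upper_ad_comm[of \<theta> xs i j]
      unfolding g pc.blk.feval_mult blk_sel_times pc.e11_feval_word pc.e12_feval_ad_comm[of _ \<theta>, OF t]
      by (simp add: strictly_upper_def prod_list_mono_of \<theta>_def)
    also have "\<dots> = mono_of (encode2 (mset u, add_mset i (mset xs), j)) - mono_of (encode2 (mset u, add_mset j (mset xs), i))"
      by (simp add: right_diff_distrib mono_of_mult encode2_def add_mset_commute)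
    finally show "1 * \<phi> g = mon_extend ?\<Lambda> (e12 (pc.blk.feval \<theta> g))"
      by (simp add: mon_extend_diff inv_f_f[OF inj_encode2] L g G)
  qed simp_all
  moreover have "pc.blk.feval \<theta> f = 0"
    using f unfolding \<theta>_def by (intro generic_feval_eq_0 star_compatible_generic_blk)
  ultimately show False
    using \<phi>(3) by simp
qed


section \<open>Identities lie in the generated ideal\<close>

definition normal_value ::
  "('a::field free_alg \<Rightarrow> 'a) \<Rightarrow> var multiset \<Rightarrow> var multiset \<Rightarrow> var \<Rightarrow> var \<Rightarrow> var multiset \<Rightarrow> var \<Rightarrow> var \<Rightarrow> 'a" where
  "normal_value \<phi> U W i j S k l =
     \<phi> (word (list_of U) * ad_comm (list_of W) i j * star (ad_comm (list_of S) k l))"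

text \<open>Sorting \<open>u\<close> changes it by an element of the commutator ideal, sorting
  \<open>xs\<close> or \<open>ys\<close> changes a commutator by an element of its square.
  Multiplied by the other factors, each error lies in the cube, hence in
  \<open>gen_ideal\<close>.\<close>

lemma normal_value_mset:
  fixes \<phi> :: "'a::field_char_0 free_alg \<Rightarrow> 'a"
  assumes \<phi>: "functional \<phi>" "\<And>g. g \<in> gen_ideal \<Longrightarrow> \<phi> g = 0"
  shows "\<phi> (word u * ad_comm xs i j * star (ad_comm ys k l)) = normal_value \<phi> (mset u) (mset xs) i j (mset ys) k l"
proof -
  let ?u = "word (list_of (mset u)) :: 'a free_alg"
  let ?v = "ad_comm xs i j :: 'a free_alg" and ?w = "ad_comm ys k l :: 'a free_alg"
  let ?v' = "ad_comm (list_of (mset xs)) i j :: 'a free_alg"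
  let ?w' = "ad_comm (list_of (mset ys)) k l :: 'a free_alg"
  have 1: "(word u - ?u) * (?v * star ?w) \<in> gen_ideal"
    by (intro comm_ideal_mult_comm_ideal2 word_perm mult_in_comm_ideal2 ad_comm_in_comm_ideal
        star_in_comm_ideal) simp
  have 2: "?u * ((?v - ?v') * star ?w) \<in> gen_ideal"
    by (intro gen_ideal_left comm_ideal_mult_comm_ideal2 ad_comm_perm ad_comm_in_comm_ideal
        star_in_comm_ideal) simp
  have 3: "?u * (?v' * star (?w - ?w')) \<in> gen_ideal"
    by (intro gen_ideal_left comm_ideal_mult_comm_ideal2 ad_comm_perm ad_comm_in_comm_ideal
        star_in_comm_ideal2) simp
  have "word u * ?v * star ?w - ?u * ?v' * star ?w' = (word u - ?u) * (?v * star ?w)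
      + ?u * ((?v - ?v') * star ?w) + ?u * (?v' * star (?w - ?w'))"
    by (simp add: star_diff algebra_simps)
  then have "\<phi> (word u * ?v * star ?w - ?u * ?v' * star ?w') = 0"
    using 1 2 3 by (intro \<phi>(2)) (simp only: gen_ideal_add)
  then show ?thesis
    by (simp add: normal_value_def functional_diff[OF \<phi>(1)])
qed

lemma normal_form_normal_value:
  fixes \<phi> :: "'a::field_char_0 free_alg \<Rightarrow> 'a"
  assumes \<phi>: "functional \<phi>" "\<And>g. g \<in> gen_ideal \<Longrightarrow> \<phi> g = 0"
  shows "normal_form (normal_value \<phi> U)"
proof
  note eval = normal_value_mset[OF \<phi>, symmetric]
  note lin = functional_add[OF \<phi>(1)] functional_diff[OF \<phi>(1)] functional_uminus[OF \<phi>(1)]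
  define u where "u = list_of U"
  have U: "U = mset u"
    by (simp add: u_def)
  fix W S :: "var multiset" and i j k l :: var
  let ?W = "list_of W" and ?S = "list_of S"
  let ?u = "word u :: 'a free_alg"
  let ?v = "ad_comm ?W i j :: 'a free_alg" and ?w = "star (ad_comm ?S k l) :: 'a free_alg"
  have val_eq: "normal_value \<phi> U W i j S k l = \<phi> (?u * ad_comm (list_of W) i j * star (ad_comm (list_of S) k l))" for W i j S k l
    by (simp add: normal_value_def u_def)
  have val_Cons: "normal_value \<phi> U (add_mset m W) i j S k l
      = \<phi> (?u * ad_comm (m # list_of W) i j * star (ad_comm (list_of S) k l))"
    "normal_value \<phi> U W i j (add_mset m S) k l
      = \<phi> (?u * ad_comm (list_of W) i j * star (ad_comm (m # list_of S) k l))" for m W i j S k l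
    using eval[of u "m # list_of W" i j "list_of S" k l] eval[of u "list_of W" i j "m # list_of S" k l]
    by (simp_all add: U)
  have f: "?v * ?w \<in> comm_ideal2"
    by (intro mult_in_comm_ideal2 ad_comm_in_comm_ideal star_in_comm_ideal)
  show "normal_value \<phi> U W j i S k l = - normal_value \<phi> U W i j S k l"
    unfolding val_eq by (simp add: ad_comm_swap[of _ j i] lin)
  show "normal_value \<phi> U (add_mset m W) i j S k l + normal_value \<phi> U (add_mset i W) j m S k l
      + normal_value \<phi> U (add_mset j W) m i S k l = 0" for m
  proof -
    have "?u * ((ad_comm (m # ?W) i j + ad_comm (i # ?W) j m + ad_comm (j # ?W) m i) * ?w) \<in> gen_ideal"
      by (intro gen_ideal_left comm_ideal_mult_comm_ideal2 ad_comm_jacobi star_in_comm_ideal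
          ad_comm_in_comm_ideal)
    from \<phi>(2)[OF this] show ?thesis
      unfolding val_Cons by (simp add: distrib_left distrib_right mult.assoc lin)
  qed
  \<comment> \<open>\<open>star\<close> sends \<open>u v star w\<close> to
    \<open>w star v star u\<close>, and twisting \<open>star u\<close> to the front gives
    \<open>u w star v\<close>.\<close>
  show "normal_value \<phi> U W i j S k l = normal_value \<phi> U S k l W i j"
  proof -
    let ?g = "ad_comm ?S k l * star (ad_comm ?W i j) :: 'a free_alg"
    have "?u * ?v * ?w - star (?u * ?v * ?w) \<in> gen_ideal"
      using comm_ideal2_star[OF comm_ideal2_left[OF f, of ?u]] by (simp add: mult.assoc)
    moreover have "?g * star ?u - star (star ?u) * ?g \<in> gen_ideal"
      by (intro comm_ideal2_mult_right mult_in_comm_ideal2 ad_comm_in_comm_ideal star_in_comm_ideal)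
    ultimately have "\<phi> (?u * ?v * ?w) = \<phi> (star (?u * ?v * ?w))" "\<phi> (?g * star ?u) = \<phi> (?u * ?g)"
      using \<phi>(2) by (force simp: lin)+
    then show ?thesis
      unfolding val_eq by (simp add: star_mult mult.assoc)
  qed
  \<comment> \<open>From \<open>[y, v] star w - v star [y, w] = y v star w - v star w y\<close>,
    whose right side lies in the ideal as \<open>star y = y\<close>.\<close>
  show "normal_value \<phi> U (add_mset (Y n) W) i j S k l = normal_value \<phi> U W i j (add_mset (Y n) S) k l" for n
  proof -
    have "?v * ?w * gen (Y n) - star (gen (Y n)) * (?v * ?w) \<in> gen_ideal"
      by (rule comm_ideal2_mult_right[OF f])
    then have "?u * (?v * ?w * gen (Y n) - gen (Y n) * (?v * ?w)) \<in> gen_ideal"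
      by (simp add: gen_ideal_left)
    from \<phi>(2)[OF this] have "\<phi> (?u * (?v * ?w * gen (Y n))) = \<phi> (?u * (gen (Y n) * (?v * ?w)))"
      by (simp add: right_diff_distrib lin)
    then show ?thesis
      unfolding val_Cons
      by (simp add: ad_comm_Cons bracket_def star_diff star_mult left_diff_distrib right_diff_distrib
          mult.assoc lin)
  qed
  show "normal_value \<phi> U {#} (Y a) (Y b) {#} (Y c) (Y d) + normal_value \<phi> U {#} (Y b) (Y c) {#} (Y a) (Y d)
      + normal_value \<phi> U {#} (Y c) (Y a) {#} (Y b) (Y d) = 0" for a b c d
  proof -
    have val_Nil: "normal_value \<phi> U {#} (Y a) (Y b) {#} (Y c) (Y d)
        = - \<phi> (?u * (bracket (gen (Y a)) (gen (Y b)) * bracket (gen (Y c)) (gen (Y d))))" for a b c d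
    proof -
      have "star (bracket (gen (Y c)) (gen (Y d))) = - bracket (gen (Y c)) (gen (Y d) :: 'a free_alg)"
        by (simp add: star_bracket) (simp add: bracket_def)
      then show ?thesis
        using eval[of u "[]" "Y a" "Y b" "[]" "Y c" "Y d"] by (simp add: U ad_comm_Nil lin mult.assoc)
    qed
    from \<phi>(2)[OF gen_ideal_left[OF pluecker_in_gen_ideal[of a b c d], of ?u]] show ?thesis
      unfolding val_Nil by (simp add: distrib_left lin) Groebner_Basis.algebra
  qed
qed

text \<open>For a symmetric variable the entries (2,2) and (3,3) coincide, so \<open>s\<close> is
  \<open>t\<close> and has no parameter of its own.\<close>

definition s_param :: "var \<Rightarrow> param" where
  "s_param x = (if is_Z x then PS x else PT x)"

lemma image_mset_s_param: "image_mset s_param S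
    = image_mset PT (filter_mset (\<lambda>x. \<not> is_Z x) S) + image_mset PS (filter_mset is_Z S)"
  by (induction S) (simp_all add: s_param_def)

lemma identity_in_gen_ideal:
  fixes f :: "'a::field_char_0 free_alg"
  assumes f: "f \<in> star_identities"
  shows "f \<in> gen_ideal"
proof (rule ccontr)
  assume "f \<notin> gen_ideal"
  then obtain \<phi> where \<phi>: "functional \<phi>" "\<And>g. g \<in> gen_ideal \<Longrightarrow> \<phi> g = 0" "\<phi> f = 1"
    using functional_separates[OF gen_ideal_subspace] by blast
  let ?N = "normal_value \<phi>"
  define L where "L = (\<lambda>(U, W, S, i, k). normal_form.contract (?N U) W S i k)"
  let ?\<Lambda> = "\<lambda>M. L (inv_into UNIV encode3 M)"
  define mon :: "_ \<Rightarrow> _ \<Rightarrow> _ \<Rightarrow> _ \<Rightarrow> _ \<Rightarrow> (param, 'a) mpoly" where "mon U W S i k = mono_of (encode3 (U,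
    W + filter_mset (\<lambda>x. \<not> is_Z x) S, filter_mset is_Z S, i, k))" for U W S i k
  have mon: "mono_of (image_mset PA U) * (mono_of (image_mset PT W) * mono_of (image_mset s_param S)
      * mono_of {#PC i#} * mono_of {#PD k#}) = mon U W S i k" for U W S i k
    by (simp add: mon_def mono_of_mult encode3_def image_mset_s_param add_ac)
  have mon_value: "mon_extend ?\<Lambda> (mon U W S i k) = normal_form.contract_ts (?N U) W S i k" for U W S i k
    using normal_form.contract_ts_def[OF normal_form_normal_value[OF \<phi>(1,2)]]
    by (simp add: mon_def inv_f_f[OF inj_encode3] L_def)
  define t :: "var \<Rightarrow> (param, 'a) mpoly" where "t x = mono_of {#PT x#}" for x
  define s :: "var \<Rightarrow> (param, 'a) mpoly" where "s x = mono_of {#s_param x#}" for x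
  define half :: "(param, 'a) mpoly" where "half = Poly_Mapping.single 0 (1/2)"
  \<comment> \<open>For a skew variable the entry (3,3) is \<open>- b\<close>, so
    \<open>t = a - b\<close> and \<open>s = a + b\<close>, whence \<open>a = (t + s) / 2\<close>. A
    symmetric variable has \<open>s = t\<close> and keeps \<open>a\<close> free.\<close>
  define a where "a x = (if is_Z x then half * (t x + s x) else mono_of {#PA x#})" for x
  define b where "b x = a x - t x" for x
  define \<theta> where "\<theta> = generic_blk a b (\<lambda>x. mono_of {#PC x#}) (\<lambda>x. mono_of {#PD x#})"
  have compat: "star_compatible \<theta>"
    unfolding \<theta>_def by (rule star_compatible_generic_blk)
  have half: "half * p + half * p = p" for p
    using distrib_right[of half half p] by (simp add: half_def flip: single_add)
  have t_eq: "t x = e11 (\<theta> x) - e22 (\<theta> x)" for x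
    by (simp add: \<theta>_def b_def)
  have s_eq: "s x = e11 (\<theta> x) - e33 (\<theta> x)" for x
  proof (cases "is_Z x")
    case True
    have "e11 (\<theta> x) - e33 (\<theta> x) = (half * t x + half * t x) + (half * s x + half * s x) - t x"
      by (simp add: True \<theta>_def b_def a_def distrib_left)
    then show ?thesis
      by (simp add: half)
  qed (simp add: \<theta>_def b_def s_def t_def s_param_def)
  have cd: "e12 (\<theta> x) = mono_of {#PC x#}" "e13 (\<theta> x) = mono_of {#PD x#}" for x
    by (simp_all add: \<theta>_def)
  \<comment> \<open>The two summands of the entry (1,4) have equal contractions by
    \<open>swap\<close>; hence the factor 2.\<close>
  have "2 * \<phi> f = mon_extend ?\<Lambda> (e14 (pc.blk.feval \<theta> f))"
  proof (rule functional_eq_mon_extend[OF \<phi>(1) subsetD[OF comm_ideal2_span_normal identity_in_comm_ideal2[OF f]]])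
    fix g :: "'a free_alg"
    assume g: "g \<in> {word (map Y u) * ad_comm xs i j * star (ad_comm ys k l) | u xs i j ys k l. True} \<union> gen_ideal"
    show "2 * \<phi> g = mon_extend ?\<Lambda> (e14 (pc.blk.feval \<theta> g))"
    \<comment> \<open>The spanning set contains the ideal itself, and there soundness makes the
      entry zero.\<close>
    proof (cases "g \<in> gen_ideal")
      case True
      then have "pc.blk.feval \<theta> g = 0"
        using gen_ideal_subset compat by (intro generic_feval_eq_0) auto
      then show ?thesis
        using True by (simp add: \<phi>(2))
    next
      case False
      with g obtain u xs i j ys k l where g: "g = word (map Y u) * ad_comm xs i j * star (ad_comm ys k l)"
        by blast
      let ?U = "image_mset Y (mset u)" and ?W = "mset xs" and ?S = "mset ys"
      \<comment> \<open>Only symmetric letters stand in front, so each \<open>a\<close> is a single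
        parameter and the product a monomial.\<close>
      have PA: "prod_list (map (\<lambda>x. e11 (\<theta> x)) (map Y u)) = mono_of (image_mset PA ?U)"
        by (induction u) (simp_all add: \<theta>_def a_def mono_of_mult)
      have T: "prod_list (map t xs) = mono_of (image_mset PT (mset xs))"
        and S: "prod_list (map s xs) = mono_of (image_mset s_param (mset xs))" for xs
        unfolding t_def s_def by (rule prod_list_mono_of)+
      have expand: "mono_of (image_mset PA ?U) * ((mono_of (image_mset PT W) * (t i * mono_of {#PC j#} - t j * mono_of {#PC i#}))
          * (mono_of (image_mset s_param S) * (s k * mono_of {#PD l#} - s l * mono_of {#PD k#})))
        = mon ?U (add_mset i W) (add_mset k S) j l - mon ?U (add_mset i W) (add_mset l S) j k
          - mon ?U (add_mset j W) (add_mset k S) i l + mon ?U (add_mset j W) (add_mset l S) i k"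
        for W S i j k l
      proof -
        have "t x * mono_of (image_mset PT W) = mono_of (image_mset PT (add_mset x W))"
          "s x * mono_of (image_mset s_param S) = mono_of (image_mset s_param (add_mset x S))" for x
          by (simp_all add: t_def s_def mono_of_mult)
        then show ?thesis
          unfolding mon[symmetric]
          by (simp only: flip: \<open>\<And>x. t x * mono_of (image_mset PT W) = _\<close> \<open>\<And>x. s x * mono_of (image_mset s_param S) = _\<close>)
             (simp add: algebra_simps)
      qed
      have "e14 (pc.blk.feval \<theta> g)
        = mono_of (image_mset PA ?U) * ((mono_of (image_mset PT ?W) * (t i * mono_of {#PC j#} - t j * mono_of {#PC i#}))
          * (mono_of (image_mset s_param ?S) * (s k * mono_of {#PD l#} - s l * mono_of {#PD k#})))
        + mono_of (image_mset PA ?U) * ((mono_of (image_mset PT ?S) * (t k * mono_of {#PC l#} - t l * mono_of {#PC k#}))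
          * (mono_of (image_mset s_param ?W) * (s i * mono_of {#PD j#} - s j * mono_of {#PD i#})))"
        unfolding g pc.e14_feval_normal[OF compat] pc.e12_feval_ad_comm[of t \<theta>, OF t_eq]
          pc.e13_feval_ad_comm[of s \<theta>, OF s_eq] PA T S cd
        by (simp only: distrib_left mult.commute)
      then have "mon_extend ?\<Lambda> (e14 (pc.blk.feval \<theta> g)) = ?N ?U ?W i j ?S k l + ?N ?U ?S k l ?W i j"
        unfolding expand
        by (simp only: mon_extend_add mon_extend_diff mon_value
            normal_form.contract_ts_alternating[OF normal_form_normal_value[OF \<phi>(1,2)]])
      also have "?N ?U ?S k l ?W i j = ?N ?U ?W i j ?S k l"
        using normal_form_normal_value[OF \<phi>(1,2)] by (rule normal_form.swap)
      also have "?N ?U ?W i j ?S k l = \<phi> g"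
        unfolding g using normal_value_mset[OF \<phi>(1,2), of "map Y u" xs i j ys k l] by simp
      finally show ?thesis
        by simp
    qed
  qed simp_all
  moreover have "pc.blk.feval \<theta> f = 0"
    using f compat by (rule generic_feval_eq_0)
  ultimately show False
    using \<phi>(3) by simp
qed

theorem theorem3p16:
  shows "(star_identities :: 'a::field_char_0 free_alg set)
    = T_star_ideal hull (gens1 \<union> gens2 \<union> gens3)"
  using gen_ideal_subset identity_in_gen_ideal unfolding gen_ideal_def by blast

end
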